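(* Let $R=R(x_0,\ldots,x_n)$ be the exterior algebra in $n+1$ indeterminates and let $M$ be an indecomposable linear $R$-module of complexity less than or equal to $n$. Then $\operatorname{Ext}^1_R(M,M)\ne 0$.
   Context: $\Bbbk$ is an algebraically closed field and $R$ is the exterior algebra over $\Bbbk$ in $x_0,\ldots,x_n$, graded with $\deg x_i=1$. All modules are finitely generated graded (right) $R$-modules; $\operatorname{Hom}_R$ denotes degree zero homomorphisms and $\operatorname{Ext}^i_R$ the derived functors of this graded $\operatorname{Hom}$ (so extensions are of graded modules with degree zero maps). A module $M$ with minimal graded free resolution $\cdots\to F^2\to F^1\to F^0\to M\to 0$ is linear if each $F^i$ is generated in degree $i$. The $i$-th Betti number $\beta_i(M)$ is the rank of $F^i$. The complexity $\operatorname{cx}M$ is the infimum of the $d\in\mathbb N=\{0,1,2,\dots\}$ for which there is a positive $c\in\mathbb Q$ with $\beta_i(M)\le c\,i^{d-1}$ for all $i\ge 1$; $\operatorname{cx}M=0$ if and only if $M$ is projective.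
   Formalization: The formal theorem also assumes that M has nonzero complexity, i.e. is not projective; as stated the claim fails for M = R, which is indecomposable and linear of complexity 0 with Ext^1(R,R) = 0. *)

theory Defs
  imports "HOL-Algebra.AbelCoset" "HOL-Computational_Algebra.Polynomial"
begin

section \<open>The exterior algebra\<close>

text \<open>
  An element of the exterior algebra in \<open>x\<^sub>0, \<dots>, x\<^sub>n\<close> is given by its coordinates with respect to
  the basis of monomials \<open>x\<^sub>S = x\<^bsub>s1\<^esub> \<and> \<dots> \<and> x\<^bsub>sk\<^esub>\<close>, where \<open>S = {s1 < \<dots> < sk} \<subseteq> {0..n}\<close>.
\<close>

type_synonym 'k ext = "nat set \<Rightarrow> 'k"

text \<open>
  For disjoint \<open>S\<close> and \<open>T\<close> we have \<open>x\<^sub>S \<and> x\<^sub>T = ext_sign S T x\<^bsub>S \<union> T\<^esub>\<close>; otherwise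
  \<open>x\<^sub>S \<and> x\<^sub>T = 0\<close>.
\<close>

definition ext_sign :: "nat set \<Rightarrow> nat set \<Rightarrow> 'k :: field" where
  "ext_sign S T = (-1) ^ card {(s, t). s \<in> S \<and> t \<in> T \<and> t < s}"

definition ext_alg :: "nat \<Rightarrow> ('k :: field) ext ring" where
  "ext_alg n =
     \<lparr>carrier = {f. \<forall>S. \<not> S \<subseteq> {0..n} \<longrightarrow> f S = 0},
      monoid.mult = (\<lambda>f g S. \<Sum>T\<in>Pow S. ext_sign T (S - T) * f T * g (S - T)),
      one = (\<lambda>S. if S = {} then 1 else 0),
      zero = (\<lambda>S. 0),
      add = (\<lambda>f g S. f S + g S)\<rparr>"

definition ext_grade :: "nat \<Rightarrow> int \<Rightarrow> ('k :: field) ext set" where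
  "ext_grade n d = {f \<in> carrier (ext_alg n). \<forall>S. f S \<noteq> 0 \<longrightarrow> int (card S) = d}"

section \<open>Graded right modules\<close>

text \<open>
  As for modules in HOL-Algebra, only the additive part of the underlying ring record is used.
  The library's modules are left modules over commutative rings and hence do not apply here.
\<close>

record ('k, 'm) graded_rmod = "'m ring" +
  ract :: "'m \<Rightarrow> 'k ext \<Rightarrow> 'm" (infixl \<open>\<triangleleft>\<index>\<close> 70)
  grade :: "int \<Rightarrow> 'm set"

locale graded_rmodule = abelian_group M
  for n :: nat and M :: "('k :: field, 'm) graded_rmod" (structure) +
  assumes ract_closed:
      "\<lbrakk>x \<in> carrier M; r \<in> carrier (ext_alg n)\<rbrakk> \<Longrightarrow> x \<triangleleft> r \<in> carrier M"
    and ract_add_left: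
      "\<lbrakk>x \<in> carrier M; y \<in> carrier M; r \<in> carrier (ext_alg n)\<rbrakk>
        \<Longrightarrow> (x \<oplus> y) \<triangleleft> r = x \<triangleleft> r \<oplus> y \<triangleleft> r"
    and ract_add_right:
      "\<lbrakk>x \<in> carrier M; r \<in> carrier (ext_alg n); s \<in> carrier (ext_alg n)\<rbrakk>
        \<Longrightarrow> x \<triangleleft> (r \<oplus>\<^bsub>ext_alg n\<^esub> s) = x \<triangleleft> r \<oplus> x \<triangleleft> s"
    and ract_mult:
      "\<lbrakk>x \<in> carrier M; r \<in> carrier (ext_alg n); s \<in> carrier (ext_alg n)\<rbrakk>
        \<Longrightarrow> x \<triangleleft> (r \<otimes>\<^bsub>ext_alg n\<^esub> s) = (x \<triangleleft> r) \<triangleleft> s"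
    and ract_one:
      "x \<in> carrier M \<Longrightarrow> x \<triangleleft> \<one>\<^bsub>ext_alg n\<^esub> = x"
    and grade_subgroup:
      "additive_subgroup (grade M d) M"
    and grade_ract:
      "\<lbrakk>x \<in> grade M d; r \<in> ext_grade n e\<rbrakk> \<Longrightarrow> x \<triangleleft> r \<in> grade M (d + e)"
    and grade_decomposition:
      "x \<in> carrier M \<Longrightarrow>
        \<exists>!c. (\<forall>d. c d \<in> grade M d) \<and> finite {d. c d \<noteq> \<zero>} \<and> x = (\<Oplus>d\<in>{d. c d \<noteq> \<zero>}. c d)"

definition rsubmodule :: "nat \<Rightarrow> 'm set \<Rightarrow> ('k :: field, 'm) graded_rmod \<Rightarrow> bool" where
  "rsubmodule n N M \<longleftrightarrow>
     additive_subgroup N M \<and> (\<forall>x\<in>N. \<forall>r\<in>carrier (ext_alg n). x \<triangleleft>\<^bsub>M\<^esub> r \<in> N)"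

definition rspan :: "nat \<Rightarrow> ('k :: field, 'm) graded_rmod \<Rightarrow> 'm set \<Rightarrow> 'm set" where
  "rspan n M X = \<Inter>{N. rsubmodule n N M \<and> X \<subseteq> N}"

definition fin_gen :: "nat \<Rightarrow> ('k :: field, 'm) graded_rmod \<Rightarrow> bool" where
  "fin_gen n M \<longleftrightarrow> (\<exists>X. finite X \<and> X \<subseteq> carrier M \<and> rspan n M X = carrier M)"

definition generated_in_degree :: "nat \<Rightarrow> int \<Rightarrow> ('k :: field, 'm) graded_rmod \<Rightarrow> bool" where
  "generated_in_degree n d M \<longleftrightarrow> rspan n M (grade M d) = carrier M"

definition graded_submodule :: "nat \<Rightarrow> 'm set \<Rightarrow> ('k :: field, 'm) graded_rmod \<Rightarrow> bool" where
  "graded_submodule n N M \<longleftrightarrow>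
     N \<subseteq> carrier M \<and> graded_rmodule n (M\<lparr>carrier := N, grade := \<lambda>d. grade M d \<inter> N\<rparr>)"

definition indecomposable :: "nat \<Rightarrow> ('k :: field, 'm) graded_rmod \<Rightarrow> bool" where
  "indecomposable n M \<longleftrightarrow>
     carrier M \<noteq> {\<zero>\<^bsub>M\<^esub>} \<and>
     (\<forall>A B. graded_submodule n A M \<and> graded_submodule n B M \<and>
            A <+>\<^bsub>M\<^esub> B = carrier M \<and> A \<inter> B = {\<zero>\<^bsub>M\<^esub>}
        \<longrightarrow> A = {\<zero>\<^bsub>M\<^esub>} \<or> B = {\<zero>\<^bsub>M\<^esub>})"

text \<open>
  Degree zero homomorphisms. They are taken to be extensional, so that equality of homomorphisms is
  equality of functions.
\<close>

definition graded_hom ::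
    "nat \<Rightarrow> ('k :: field, 'm) graded_rmod \<Rightarrow> ('k, 'p) graded_rmod \<Rightarrow> ('m \<Rightarrow> 'p) set" where
  "graded_hom n M N =
     {h \<in> carrier M \<rightarrow>\<^sub>E carrier N.
        (\<forall>x\<in>carrier M. \<forall>y\<in>carrier M. h (x \<oplus>\<^bsub>M\<^esub> y) = h x \<oplus>\<^bsub>N\<^esub> h y) \<and>
        (\<forall>x\<in>carrier M. \<forall>r\<in>carrier (ext_alg n). h (x \<triangleleft>\<^bsub>M\<^esub> r) = h x \<triangleleft>\<^bsub>N\<^esub> r) \<and>
        (\<forall>d. h ` grade M d \<subseteq> grade N d)}"

definition hom_group ::
    "nat \<Rightarrow> ('k :: field, 'm) graded_rmod \<Rightarrow> ('k, 'p) graded_rmod \<Rightarrow> ('m \<Rightarrow> 'p) monoid" where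
  "hom_group n M N =
     \<lparr>carrier = graded_hom n M N,
      monoid.mult = (\<lambda>g h. \<lambda>x\<in>carrier M. g x \<oplus>\<^bsub>N\<^esub> h x),
      one = (\<lambda>x\<in>carrier M. \<zero>\<^bsub>N\<^esub>)\<rparr>"

section \<open>Minimal graded free resolutions\<close>

text \<open>
  \<open>graded_free n ds\<close> is the graded free module with basis \<open>e\<^sub>0, e\<^sub>1, \<dots>\<close> where \<open>e\<^sub>i\<close> has degree
  \<open>ds ! i\<close>; its rank is \<open>length ds\<close>. Up to isomorphism, these are all the finitely generated graded
  free modules.
\<close>

type_synonym 'k free_vec = "nat \<Rightarrow> 'k ext"

definition graded_free :: "nat \<Rightarrow> int list \<Rightarrow> ('k :: field, 'k free_vec) graded_rmod" where
  "graded_free n ds =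
     \<lparr>carrier = {v. (\<forall>i<length ds. v i \<in> carrier (ext_alg n)) \<and>
                    (\<forall>i\<ge>length ds. v i = \<zero>\<^bsub>ext_alg n\<^esub>)},
      monoid.mult = undefined,
      one = undefined,
      zero = (\<lambda>i. \<zero>\<^bsub>ext_alg n\<^esub>),
      add = (\<lambda>v w i. v i \<oplus>\<^bsub>ext_alg n\<^esub> w i),
      ract = (\<lambda>v r i. v i \<otimes>\<^bsub>ext_alg n\<^esub> r),
      grade = (\<lambda>d. {v. (\<forall>i<length ds. v i \<in> ext_grade n (d - ds ! i)) \<and>
                       (\<forall>i\<ge>length ds. v i = \<zero>\<^bsub>ext_alg n\<^esub>)})\<rparr>"

text \<open>
  \<open>res_bdry F i\<close> is the differential from the free module in position \<open>i + 1\<close> to the one in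
  position \<open>i\<close>, and \<open>res_aug F\<close> is the augmentation onto the resolved module.
\<close>

record ('k, 'm) resolution =
  res_degs :: "nat \<Rightarrow> int list"
  res_bdry :: "nat \<Rightarrow> 'k free_vec \<Rightarrow> 'k free_vec"
  res_aug :: "'k free_vec \<Rightarrow> 'm"

definition res_mod ::
    "nat \<Rightarrow> ('k :: field, 'm) resolution \<Rightarrow> nat \<Rightarrow> ('k, 'k free_vec) graded_rmod" where
  "res_mod n F i = graded_free n (res_degs F i)"

definition free_resolution ::
    "nat \<Rightarrow> ('k :: field, 'm) graded_rmod \<Rightarrow> ('k, 'm) resolution \<Rightarrow> bool" where
  "free_resolution n M F \<longleftrightarrow>
     res_aug F \<in> graded_hom n (res_mod n F 0) M \<and>
     (\<forall>i. res_bdry F i \<in> graded_hom n (res_mod n F (Suc i)) (res_mod n F i)) \<and>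
     res_aug F ` carrier (res_mod n F 0) = carrier M \<and>
     a_kernel (res_mod n F 0) M (res_aug F) = res_bdry F 0 ` carrier (res_mod n F (Suc 0)) \<and>
     (\<forall>i. a_kernel (res_mod n F (Suc i)) (res_mod n F i) (res_bdry F i) =
            res_bdry F (Suc i) ` carrier (res_mod n F (Suc (Suc i))))"

text \<open>\<open>M \<cdot> \<mm>\<close>, where \<open>\<mm> = (x\<^sub>0, \<dots>, x\<^sub>n)\<close> is the ideal of elements with constant term zero.\<close>

definition rad_part :: "nat \<Rightarrow> ('k :: field, 'm) graded_rmod \<Rightarrow> 'm set" where
  "rad_part n M = rspan n M {x \<triangleleft>\<^bsub>M\<^esub> r | x r. x \<in> carrier M \<and> r \<in> carrier (ext_alg n) \<and> r {} = 0}"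

definition minimal_resolution ::
    "nat \<Rightarrow> ('k :: field, 'm) graded_rmod \<Rightarrow> ('k, 'm) resolution \<Rightarrow> bool" where
  "minimal_resolution n M F \<longleftrightarrow>
     free_resolution n M F \<and>
     (\<forall>i. res_bdry F i ` carrier (res_mod n F (Suc i)) \<subseteq> rad_part n (res_mod n F i))"

definition linear_module :: "nat \<Rightarrow> ('k :: field, 'm) graded_rmod \<Rightarrow> bool" where
  "linear_module n M \<longleftrightarrow>
     (\<exists>F. minimal_resolution n M F \<and> (\<forall>i. generated_in_degree n (int i) (res_mod n F i)))"

text \<open>
  For finitely generated \<open>M\<close>, a minimal resolution exists and is unique up to isomorphism, so
  the Betti numbers do not depend on the choice made here.
\<close>

definition betti :: "nat \<Rightarrow> ('k :: field, 'm) graded_rmod \<Rightarrow> nat \<Rightarrow> nat" where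
  "betti n M i = length (res_degs (SOME F. minimal_resolution n M F) i)"

definition complexity :: "nat \<Rightarrow> ('k :: field, 'm) graded_rmod \<Rightarrow> nat" where
  "complexity n M =
     Inf {d. \<exists>c :: rat. c > 0 \<and> (\<forall>i\<ge>1. of_nat (betti n M i) \<le> c * of_nat i powi (int d - 1))}"

section \<open>Ext\<close>

text \<open>
  The cohomology in degree \<open>i\<close> of the complex \<open>Hom(F\<^sub>0, N) \<rightarrow> Hom(F\<^sub>1, N) \<rightarrow> \<dots>\<close> for a free
  resolution \<open>F\<close>: cocycles modulo coboundaries.
\<close>

definition res_cocycles ::
    "nat \<Rightarrow> ('k :: field, 'm) resolution \<Rightarrow> ('k, 'p) graded_rmod \<Rightarrow> nat \<Rightarrow>
     ('k free_vec \<Rightarrow> 'p) set" where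
  "res_cocycles n F N i =
     {h \<in> graded_hom n (res_mod n F i) N.
        \<forall>x\<in>carrier (res_mod n F (Suc i)). h (res_bdry F i x) = \<zero>\<^bsub>N\<^esub>}"

fun res_coboundaries ::
    "nat \<Rightarrow> ('k :: field, 'm) resolution \<Rightarrow> ('k, 'p) graded_rmod \<Rightarrow> nat \<Rightarrow>
     ('k free_vec \<Rightarrow> 'p) set" where
  "res_coboundaries n F N 0 = {\<one>\<^bsub>hom_group n (res_mod n F 0) N\<^esub>}"
| "res_coboundaries n F N (Suc i) =
     (\<lambda>h. compose (carrier (res_mod n F (Suc i))) h (res_bdry F i)) ` graded_hom n (res_mod n F i) N"

definition res_cohomology ::
    "nat \<Rightarrow> ('k :: field, 'm) resolution \<Rightarrow> ('k, 'p) graded_rmod \<Rightarrow> nat \<Rightarrow>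
     ('k free_vec \<Rightarrow> 'p) set monoid" where
  "res_cohomology n F N i =
     (hom_group n (res_mod n F i) N)\<lparr>carrier := res_cocycles n F N i\<rparr> Mod res_coboundaries n F N i"

text \<open>Up to isomorphism, this does not depend on the choice of the resolution.\<close>

definition Ext ::
    "nat \<Rightarrow> nat \<Rightarrow> ('k :: field, 'm) graded_rmod \<Rightarrow> ('k, 'p) graded_rmod \<Rightarrow>
     ('k free_vec \<Rightarrow> 'p) set monoid" where
  "Ext n i M N = res_cohomology n (SOME F. free_resolution n M F) N i"

end

theory Submission
  imports Defs "HOL-Library.FuncSet" "HOL-Library.Function_Algebras" "HOL-Library.Multiset"
begin

text \<open>
  The differential of a linear resolution \<open>F\<close> of \<open>M\<close> is given by commuting operators
  \<open>A\<^sub>0, \<dots>, A\<^sub>n\<close> which lower the degree on the space \<open>V = \<Oplus>V\<^sub>i\<close> of generators and have no common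
  kernel in positive degrees: \<open>V\<close> is the dual of a module over the polynomial ring (Bernstein,
  Gelfand and Gelfand). If \<open>Ext\<^sup>1(M, M) = 0\<close>, this structure is rigid, so any change of coordinates
  \<open>A\<^sub>j + t c\<^sub>j A\<^sub>p\<close> can be undone by a formal power series in \<open>t\<close> of automorphisms. Hence, if a
  polynomial \<open>f\<close> of degree \<open>d\<close> annihilates \<open>V\<close>, so does \<open>f(A\<^sub>0 + t c\<^sub>0 A\<^sub>p, \<dots>, A\<^sub>n + t c\<^sub>n A\<^sub>p)\<close>, and
  in particular its coefficient \<open>f(c) A\<^sub>p\<^sup>d\<close> at \<open>t\<^sup>d\<close>. Complexity at most \<open>n\<close> yields such an
  \<open>f \<noteq> 0\<close> by counting monomials. Choosing \<open>c\<close> with \<open>f(c) \<noteq> 0\<close>, all \<open>A\<^sub>p\<close> are nilpotent, so \<open>V\<close> is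
  finite dimensional and the complexity is \<open>0\<close>. Working with power series rather than derivations
  makes this independent of the characteristic.
\<close>

section \<open>Graded free modules over the exterior algebra\<close>

text \<open>Replacing \<open>A j\<close> by \<open>A j + t c_j A p\<close> is a linear change of
  variables, so the deformed operators commute again. On the resolution it turns the differential
  \<open>d\<close> into \<open>d + t \<tau>\<close>, which squares to zero exactly, with no further
  terms in t. A series P(t) with P(t) (d + t \<tau>) = d P(t) is built one coefficient at a time:
  the obstruction to the next coefficient is a 1-cocycle with values in M, and the vanishing of
  Ext^1(M, M) removes it.

  The relation f need only hold for maps from V_d to V_0. This is what makes the count possible: it
  amounts to \<open>r 0 * r d\<close> linear conditions, of order at most d^(n-1), while there are
  of the order of d^n monomials of degree d in n + 1 variables. Once the d-th power of each
  \<open>A p\<close> vanishes from V_d to V_0, the absence of a common kernel carries this to all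
  other degrees.

  Complexity 0 has to be excluded: R itself is linear and indecomposable, and Ext^1(R, R) =
  0.\<close>

definition ext_mul :: "('k :: field) ext \<Rightarrow> 'k ext \<Rightarrow> 'k ext" where
  "ext_mul f g S = (\<Sum>T\<in>Pow S. ext_sign T (S - T) * f T * g (S - T))"

lemma ext_alg_simps [simp]:
  "f \<otimes>\<^bsub>ext_alg n\<^esub> g = ext_mul f g"
  "\<one>\<^bsub>ext_alg n\<^esub> = (\<lambda>S. if S = {} then 1 else 0)"
  "\<zero>\<^bsub>ext_alg n\<^esub> = 0"
  "f \<oplus>\<^bsub>ext_alg n\<^esub> g = f + g"
  by (auto simp: ext_alg_def ext_mul_def fun_eq_iff)

lemma ext_carrier_iff: "f \<in> carrier (ext_alg n) \<longleftrightarrow> (\<forall>S. f S \<noteq> 0 \<longrightarrow> S \<subseteq> {0..n})"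
  by (auto simp: ext_alg_def)

lemma ext_grade_iff:
  "f \<in> ext_grade n d \<longleftrightarrow> (\<forall>S. f S \<noteq> 0 \<longrightarrow> S \<subseteq> {0..n} \<and> int (card S) = d)"
  by (auto simp: ext_grade_def ext_carrier_iff)

lemma ext_sign_Un_left:
  assumes "finite S" "finite T" "finite U" "S \<inter> T = {}"
  shows "ext_sign (S \<union> T) U = (ext_sign S U * ext_sign T U :: 'k :: field)"
proof -
  let ?inv = "\<lambda>S. {(s, t). s \<in> S \<and> t \<in> U \<and> t < s}"
  have fin: "finite (?inv S)" if "finite S" for S
    by (rule finite_subset[of _ "S \<times> U"]) (use that assms in auto)
  have "?inv (S \<union> T) = ?inv S \<union> ?inv T" "?inv S \<inter> ?inv T = {}"
    using assms by auto
  then have "card (?inv (S \<union> T)) = card (?inv S) + card (?inv T)"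
    using fin assms by (simp add: card_Un_disjoint)
  then show ?thesis by (simp add: ext_sign_def power_add)
qed

lemma ext_sign_Un_right:
  assumes "finite S" "finite T" "finite U" "S \<inter> T = {}"
  shows "ext_sign U (S \<union> T) = (ext_sign U S * ext_sign U T :: 'k :: field)"
proof -
  let ?inv = "\<lambda>S. {(s, t). s \<in> U \<and> t \<in> S \<and> t < s}"
  have fin: "finite (?inv S)" if "finite S" for S
    by (rule finite_subset[of _ "U \<times> S"]) (use that assms in auto)
  have "?inv (S \<union> T) = ?inv S \<union> ?inv T" "?inv S \<inter> ?inv T = {}"
    using assms by auto
  then have "card (?inv (S \<union> T)) = card (?inv S) + card (?inv T)"
    using fin assms by (simp add: card_Un_disjoint)
  then show ?thesis by (simp add: ext_sign_def power_add)
qed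

lemma ext_sign_empty [simp]: "ext_sign {} S = 1" "ext_sign S {} = 1"
  by (simp_all add: ext_sign_def)

text \<open>\<open>Pow S\<close> is then infinite, and \<open>sum\<close> over an infinite set is 0.
  This default agrees with the carrier, whose elements are supported on subsets of
  \<open>{0..n}\<close>.\<close>

lemma ext_mul_infinite: "infinite S \<Longrightarrow> ext_mul f g S = 0"
  by (simp add: ext_mul_def)

text \<open>Both sides are sums over the ways to split \<open>S\<close> into three disjoint pieces.
  The signs agree because the number of inversions is additive in each argument of
  \<open>ext_sign\<close>.\<close>

lemma ext_mul_assoc: "ext_mul (ext_mul f g) h = ext_mul f (ext_mul g h)"
proof
  fix S :: "nat set"
  show "ext_mul (ext_mul f g) h S = ext_mul f (ext_mul g h) S"
  proof (cases "finite S")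
    case True
    have "ext_mul (ext_mul f g) h S =
        (\<Sum>T\<in>Pow S. \<Sum>U\<in>Pow T. ext_sign T (S - T) * ext_sign U (T - U) * f U * g (T - U) * h (S - T))"
      unfolding ext_mul_def by (simp add: sum_distrib_left sum_distrib_right mult.assoc)
    also have "\<dots> = (\<Sum>(T, U)\<in>Sigma (Pow S) Pow.
        ext_sign T (S - T) * ext_sign U (T - U) * f U * g (T - U) * h (S - T))"
      using True by (subst sum.Sigma) (auto intro: finite_subset)
    also have "\<dots> = (\<Sum>(U, W)\<in>Sigma (Pow S) (\<lambda>U. Pow (S - U)).
        ext_sign U (S - U) * f U * (ext_sign W (S - U - W) * g W * h (S - U - W)))"
    proof (rule sum.reindex_bij_witness[where i = "\<lambda>(U, W). (U \<union> W, U)" and j = "\<lambda>(T, U). (U, T - U)"])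
      fix a assume "a \<in> Sigma (Pow S) Pow"
      then obtain T U where a: "a = (T, U)" "T \<subseteq> S" "U \<subseteq> T" by auto
      then have fin: "finite T" "finite U" using True by (auto intro: finite_subset)
      define W V where "W = T - U" and "V = S - T"
      have T: "T = U \<union> W" and SU: "S - U = W \<union> V" and SUW: "S - U - W = V"
        and disj: "U \<inter> W = {}" "W \<inter> V = {}" and fin': "finite U" "finite W" "finite V"
        using a True fin unfolding W_def V_def by auto
      have "ext_sign T V * ext_sign U W = ext_sign U (S - U) * (ext_sign W V :: 'a)"
        unfolding T SU using disj fin' by (simp add: ext_sign_Un_left ext_sign_Un_right)
      then show "(case case a of (T, U) \<Rightarrow> (U, T - U) of (U, W) \<Rightarrow>
            ext_sign U (S - U) * f U * (ext_sign W (S - U - W) * g W * h (S - U - W))) =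
          (case a of (T, U) \<Rightarrow> ext_sign T (S - T) * ext_sign U (T - U) * f U * g (T - U) * h (S - T))"
        unfolding a by (simp add: SUW flip: W_def V_def)
    qed auto
    also have "\<dots> = ext_mul f (ext_mul g h) S"
      unfolding ext_mul_def using True
      by (subst sum.Sigma[symmetric]) (auto simp: sum_distrib_left)
    finally show ?thesis .
  qed (simp add: ext_mul_infinite)
qed

lemma ext_mul_add_left: "ext_mul (f + g) h = ext_mul f h + ext_mul g h"
  by (simp add: ext_mul_def fun_eq_iff algebra_simps sum.distrib)

lemma ext_mul_add_right: "ext_mul f (g + h) = ext_mul f g + ext_mul f h"
  by (simp add: ext_mul_def fun_eq_iff algebra_simps sum.distrib)

lemma ext_mul_zero_left [simp]: "ext_mul 0 h = 0"
  by (simp add: ext_mul_def fun_eq_iff)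

lemma ext_mul_nonzeroE:
  assumes "ext_mul f g S \<noteq> 0"
  obtains T where "T \<subseteq> S" "finite S" "f T \<noteq> 0" "g (S - T) \<noteq> 0"
proof -
  from assms have "finite S" using ext_mul_infinite by blast
  from assms have "\<exists>T\<in>Pow S. ext_sign T (S - T) * f T * g (S - T) \<noteq> 0"
    unfolding ext_mul_def by (meson sum.neutral)
  then show ?thesis using that \<open>finite S\<close> by force
qed

lemma ext_mul_closed:
  assumes "f \<in> carrier (ext_alg n)" "g \<in> carrier (ext_alg n)"
  shows "ext_mul f g \<in> carrier (ext_alg n)"
  unfolding ext_carrier_iff
proof (intro allI impI)
  fix S assume "ext_mul f g S \<noteq> 0"
  then obtain T where "T \<subseteq> S" "f T \<noteq> 0" "g (S - T) \<noteq> 0" by (rule ext_mul_nonzeroE)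
  then have "T \<subseteq> {0..n}" "S - T \<subseteq> {0..n}" using assms by (auto simp: ext_carrier_iff)
  then show "S \<subseteq> {0..n}" by blast
qed

lemma ext_mul_grade:
  assumes "f \<in> ext_grade n d" "g \<in> ext_grade n e"
  shows "ext_mul f g \<in> ext_grade n (d + e)"
  unfolding ext_grade_iff
proof (intro allI impI)
  fix S assume "ext_mul f g S \<noteq> 0"
  then obtain T where T: "T \<subseteq> S" "finite S" "f T \<noteq> 0" "g (S - T) \<noteq> 0" by (rule ext_mul_nonzeroE)
  then have "T \<subseteq> {0..n}" "S - T \<subseteq> {0..n}" "int (card T) = d" "int (card (S - T)) = e"
    using assms by (auto simp: ext_grade_iff)
  moreover have "card S = card T + card (S - T)"
    using T by (metis card_Diff_subset card_mono finite_subset le_add_diff_inverse)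
  ultimately show "S \<subseteq> {0..n} \<and> int (card S) = d + e" by auto
qed

lemma ext_mul_one_right:
  assumes "f \<in> carrier (ext_alg n)"
  shows "ext_mul f (\<lambda>S. if S = {} then 1 else 0) = f"
proof
  fix S
  show "ext_mul f (\<lambda>S. if S = {} then 1 else 0) S = f S"
  proof (cases "finite S")
    case True
    have "ext_mul f (\<lambda>S. if S = {} then 1 else 0) S = (\<Sum>T\<in>{S}. f S)"
      unfolding ext_mul_def using True by (intro sum.mono_neutral_cong_right) auto
    then show ?thesis by simp
  next
    case False
    then have "\<not> S \<subseteq> {0..n}" by (metis finite_atLeastAtMost finite_subset)
    then show ?thesis using assms False by (metis ext_carrier_iff ext_mul_infinite)
  qed
qed

lemma ext_mul_one_left:
  assumes "f \<in> carrier (ext_alg n)"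
  shows "ext_mul (\<lambda>S. if S = {} then 1 else 0) f = f"
proof
  fix S
  show "ext_mul (\<lambda>S. if S = {} then 1 else 0) f S = f S"
  proof (cases "finite S")
    case True
    then show ?thesis
      unfolding ext_mul_def by (subst sum.mono_neutral_right[of _ "{{}}"]) auto
  next
    case False
    then have "\<not> S \<subseteq> {0..n}" by (metis finite_atLeastAtMost finite_subset)
    then show ?thesis using assms False by (metis ext_carrier_iff ext_mul_infinite)
  qed
qed

lemma sum_fun_apply: "sum f A x = (\<Sum>a\<in>A. f a x)"
  by (induction A rule: infinite_finite_induct) auto

section \<open>Graded free modules as graded right modules\<close>

lemma graded_free_simps [simp]:
  "v \<oplus>\<^bsub>graded_free n ds\<^esub> w = v + w"
  "\<zero>\<^bsub>graded_free n ds\<^esub> = 0"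
  "v \<triangleleft>\<^bsub>graded_free n ds\<^esub> r = (\<lambda>i. ext_mul (v i) r)"
  by (auto simp: graded_free_def fun_eq_iff)

lemma free_carrier_iff:
  "v \<in> carrier (graded_free n ds) \<longleftrightarrow> (\<forall>i S. v i S \<noteq> 0 \<longrightarrow> i < length ds \<and> S \<subseteq> {0..n})"
proof -
  have "v \<in> carrier (graded_free n ds) \<longleftrightarrow>
      (\<forall>i<length ds. \<forall>S. v i S \<noteq> 0 \<longrightarrow> S \<subseteq> {0..n}) \<and> (\<forall>i\<ge>length ds. \<forall>S. v i S = 0)"
    by (simp add: graded_free_def ext_carrier_iff fun_eq_iff)
  then show ?thesis by (meson not_le)
qed

lemma free_grade_iff:
  "v \<in> grade (graded_free n ds) d \<longleftrightarrow>
     (\<forall>i S. v i S \<noteq> 0 \<longrightarrow> i < length ds \<and> S \<subseteq> {0..n} \<and> int (card S) = d - ds ! i)"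
proof -
  have "v \<in> grade (graded_free n ds) d \<longleftrightarrow>
      (\<forall>i<length ds. \<forall>S. v i S \<noteq> 0 \<longrightarrow> S \<subseteq> {0..n} \<and> int (card S) = d - ds ! i) \<and>
      (\<forall>i\<ge>length ds. \<forall>S. v i S = 0)"
    by (simp add: graded_free_def ext_grade_iff fun_eq_iff)
  then show ?thesis by (meson not_le)
qed

lemma free_grade_closed: "v \<in> grade (graded_free n ds) d \<Longrightarrow> v \<in> carrier (graded_free n ds)"
  by (simp add: free_carrier_iff free_grade_iff)

lemma free_coord_closed: "v \<in> carrier (graded_free n ds) \<Longrightarrow> v i \<in> carrier (ext_alg n)"
  by (simp add: free_carrier_iff ext_carrier_iff)

lemma free_add_closed:
  assumes "v \<in> carrier (graded_free n ds)" "w \<in> carrier (graded_free n ds)"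
  shows "v + w \<in> carrier (graded_free n ds)"
  using assms unfolding free_carrier_iff by (metis add.right_neutral plus_fun_apply)

lemma free_uminus_closed:
  assumes "v \<in> carrier (graded_free n ds)"
  shows "- v \<in> carrier (graded_free n ds)"
  using assms unfolding free_carrier_iff by simp

lemma free_zero_closed: "0 \<in> carrier (graded_free n ds)"
  by (simp add: free_carrier_iff)

lemma free_abelian_group: "abelian_group (graded_free n ds)"
proof (rule abelian_groupI)
  fix x assume "x \<in> carrier (graded_free n ds)"
  then show "\<exists>y\<in>carrier (graded_free n ds). y \<oplus>\<^bsub>graded_free n ds\<^esub> x = \<zero>\<^bsub>graded_free n ds\<^esub>"
    by (intro bexI[of _ "- x"]) (auto simp: free_uminus_closed)
qed (auto simp: add.assoc free_add_closed free_zero_closed add.commute)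

text \<open>Trades the sums of the abstract group for pointwise ones, so that coordinates can be
  computed with \<open>sum\<close>.\<close>

lemma free_finsum:
  assumes "finite A" "\<And>a. a \<in> A \<Longrightarrow> f a \<in> carrier (graded_free n ds)"
  shows "finsum (graded_free n ds) f A = sum f A"
proof -
  interpret abelian_group "graded_free n ds" by (rule free_abelian_group)
  show ?thesis using assms
  proof (induction A rule: finite_induct)
    case (insert a A)
    then show ?case by (subst finsum_insert) auto
  qed simp
qed

lemma free_ract_closed:
  assumes "v \<in> carrier (graded_free n ds)" "r \<in> carrier (ext_alg n)"
  shows "(\<lambda>i. ext_mul (v i) r) \<in> carrier (graded_free n ds)"
  unfolding free_carrier_iff
proof (intro allI impI)
  fix i S assume *: "ext_mul (v i) r S \<noteq> 0"
  then obtain T where "v i T \<noteq> 0" by (rule ext_mul_nonzeroE)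
  moreover have "ext_mul (v i) r \<in> carrier (ext_alg n)"
    using free_coord_closed[OF assms(1)] assms(2) by (rule ext_mul_closed)
  ultimately show "i < length ds \<and> S \<subseteq> {0..n}"
    using * assms(1) unfolding ext_carrier_iff free_carrier_iff by blast
qed

lemma free_graded_rmodule: "graded_rmodule n (graded_free n ds :: ('k :: field, _) graded_rmod)"
proof -
  let ?F = "graded_free n ds :: ('k, 'k free_vec) graded_rmod"
  interpret abelian_group ?F by (rule free_abelian_group)
  show ?thesis
  proof (intro graded_rmodule.intro graded_rmodule_axioms.intro free_abelian_group)
    fix x :: "'k free_vec" and r s :: "'k ext"
    assume x: "x \<in> carrier ?F" and r: "r \<in> carrier (ext_alg n)" and s: "s \<in> carrier (ext_alg n)"
    show "x \<triangleleft>\<^bsub>?F\<^esub> r \<in> carrier ?F" using x r by (simp add: free_ract_closed)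
    show "x \<triangleleft>\<^bsub>?F\<^esub> (r \<oplus>\<^bsub>ext_alg n\<^esub> s) = x \<triangleleft>\<^bsub>?F\<^esub> r \<oplus>\<^bsub>?F\<^esub> x \<triangleleft>\<^bsub>?F\<^esub> s"
      by (simp add: ext_mul_add_right fun_eq_iff)
    show "x \<triangleleft>\<^bsub>?F\<^esub> (r \<otimes>\<^bsub>ext_alg n\<^esub> s) = (x \<triangleleft>\<^bsub>?F\<^esub> r) \<triangleleft>\<^bsub>?F\<^esub> s"
      by (simp add: ext_mul_assoc fun_eq_iff)
  next
    fix x :: "'k free_vec"
    assume x: "x \<in> carrier ?F"
    show "x \<triangleleft>\<^bsub>?F\<^esub> \<one>\<^bsub>ext_alg n\<^esub> = x"
      using ext_mul_one_right[OF free_coord_closed[OF x]] by simp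
  next
    fix x y :: "'k free_vec" and r :: "'k ext"
    assume "x \<in> carrier ?F" "y \<in> carrier ?F" "r \<in> carrier (ext_alg n)"
    show "(x \<oplus>\<^bsub>?F\<^esub> y) \<triangleleft>\<^bsub>?F\<^esub> r = x \<triangleleft>\<^bsub>?F\<^esub> r \<oplus>\<^bsub>?F\<^esub> y \<triangleleft>\<^bsub>?F\<^esub> r"
      by (simp add: ext_mul_add_left fun_eq_iff)
  next
    fix d
    show "additive_subgroup (grade ?F d) ?F"
    proof (rule additive_subgroupI, rule group.subgroupI[OF a_group])
      show "grade ?F d \<subseteq> carrier (add_monoid ?F)" using free_grade_closed by auto
      show "grade ?F d \<noteq> {}" using free_grade_iff[of 0] by force
    next
      fix a assume a: "a \<in> grade ?F d"
      have "a \<oplus>\<^bsub>?F\<^esub> (- a) = \<zero>\<^bsub>?F\<^esub>" "- a \<in> carrier ?F" "a \<in> carrier ?F"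
        using a free_uminus_closed free_grade_closed[OF a] by auto
      then have "\<ominus>\<^bsub>?F\<^esub> a = - a" by (metis minus_equality add.m_comm)
      moreover have "- a \<in> grade ?F d" using a by (simp add: free_grade_iff)
      ultimately show "inv\<^bsub>add_monoid ?F\<^esub> a \<in> grade ?F d" by (simp add: a_inv_def)
    next
      fix a b assume "a \<in> grade ?F d" "b \<in> grade ?F d"
      then show "a \<otimes>\<^bsub>add_monoid ?F\<^esub> b \<in> grade ?F d"
        unfolding free_grade_iff by simp (metis add.right_neutral)
    qed
  next
    fix x :: "'k free_vec" and r :: "'k ext" and d e
    assume x: "x \<in> grade ?F d" and r: "r \<in> ext_grade n e"
    show "x \<triangleleft>\<^bsub>?F\<^esub> r \<in> grade ?F (d + e)"
      unfolding free_grade_iff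
    proof (intro allI impI)
      fix i S assume *: "(x \<triangleleft>\<^bsub>?F\<^esub> r) i S \<noteq> 0"
      then obtain T where "x i T \<noteq> 0" by (auto elim: ext_mul_nonzeroE)
      then have i: "i < length ds" using x by (auto simp: free_grade_iff)
      have "x i \<in> ext_grade n (d - ds ! i)" using x by (auto simp: free_grade_iff ext_grade_iff)
      from ext_mul_grade[OF this r] * i
      show "i < length ds \<and> S \<subseteq> {0..n} \<and> int (card S) = d + e - ds ! i"
        by (auto simp: ext_grade_iff)
    qed
  next
    fix x :: "'k free_vec"
    assume x: "x \<in> carrier ?F"
    define c where "c = (\<lambda>d i S. if int (card S) = d - ds ! i then x i S else 0)"
    have c_grade: "c d \<in> grade ?F d" for d using x by (auto simp: c_def free_grade_iff free_carrier_iff)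
    have supp: "{d. c d \<noteq> 0} \<subseteq> (\<lambda>(i, S). int (card S) + ds ! i) ` ({..<length ds} \<times> Pow {0..n})"
    proof
      fix d assume "d \<in> {d. c d \<noteq> 0}"
      then obtain i S where "c d i S \<noteq> 0" by (auto simp: fun_eq_iff)
      then have "int (card S) = d - ds ! i" "x i S \<noteq> 0" by (auto simp: c_def split: if_splits)
      then show "d \<in> (\<lambda>(i, S). int (card S) + ds ! i) ` ({..<length ds} \<times> Pow {0..n})"
        using x by (intro image_eqI[of _ _ "(i, S)"]) (auto simp: free_carrier_iff)
    qed
    \<comment> \<open>At the coordinate \<open>(i, S)\<close> only the component of degree
      \<open>card S + ds ! i\<close> can contribute. Applied to \<open>c\<close> this gives
      existence of the decomposition, applied to any other family it gives uniqueness.\<close>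
    have eval: "(\<Sum>d\<in>{d. c d \<noteq> 0}. c d) i S = c (int (card S) + ds ! i) i S"
      if "finite {d. c d \<noteq> 0}" "\<forall>d. c d \<in> grade ?F d" for c :: "int \<Rightarrow> 'k free_vec" and i S
    proof -
      have "(\<Sum>d\<in>{d. c d \<noteq> 0}. c d) i S = (\<Sum>d\<in>{d. c d \<noteq> 0}. c d i S)"
        by (simp add: sum_fun_apply)
      also have "\<dots> = (\<Sum>d\<in>{int (card S) + ds ! i}. c d i S)"
      proof (rule sum.mono_neutral_cong)
        show "c d i S = 0" if "d \<in> {d. c d \<noteq> 0} - {int (card S) + ds ! i}" for d
          using that \<open>\<forall>d. c d \<in> grade ?F d\<close> by (force simp: free_grade_iff)
      qed (use that in auto)
      finally show ?thesis by simp
    qed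
    show "\<exists>!c. (\<forall>d. c d \<in> grade ?F d) \<and> finite {d. c d \<noteq> \<zero>\<^bsub>?F\<^esub>} \<and>
        x = finsum ?F c {d. c d \<noteq> \<zero>\<^bsub>?F\<^esub>}"
    proof (intro ex1I conjI allI)
      show "c d \<in> grade ?F d" for d by (rule c_grade)
      show fin: "finite {d. c d \<noteq> \<zero>\<^bsub>?F\<^esub>}" using supp by (simp add: finite_subset)
      have "finsum ?F c {d. c d \<noteq> \<zero>\<^bsub>?F\<^esub>} = sum c {d. c d \<noteq> 0}"
        using fin by (subst free_finsum) (auto intro: free_grade_closed[OF c_grade])
      also have "\<dots> = x" using eval[of c] fin c_grade by (auto simp: fun_eq_iff c_def)
      finally show "x = finsum ?F c {d. c d \<noteq> \<zero>\<^bsub>?F\<^esub>}" by simp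
    next
      fix c' assume c': "(\<forall>d. c' d \<in> grade ?F d) \<and> finite {d. c' d \<noteq> \<zero>\<^bsub>?F\<^esub>} \<and>
        x = finsum ?F c' {d. c' d \<noteq> \<zero>\<^bsub>?F\<^esub>}"
      moreover have "c' d \<in> carrier ?F" for d using c' free_grade_closed by blast
      ultimately have "x = sum c' {d. c' d \<noteq> 0}" using free_finsum[of "{d. c' d \<noteq> 0}" c' n ds] by auto
      then have eq: "x i S = c' (int (card S) + ds ! i) i S" for i S using c' eval[of c'] by auto
      show "c' = c"
      proof (intro ext)
        fix d i S
        show "c' d i S = c d i S"
        proof (cases "int (card S) = d - ds ! i")
          case False
          then have "c' d i S = 0" using c' by (auto simp: free_grade_iff)
          then show ?thesis using False by (simp add: c_def)
        qed (simp add: eq c_def)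
      qed
    qed
  qed
qed

section \<open>Homomorphisms and lifting\<close>

context graded_rmodule
begin

lemma grade_closed: "x \<in> grade M d \<Longrightarrow> x \<in> carrier M"
  using additive_subgroup.a_subset[OF grade_subgroup] by blast

lemma zero_in_grade: "\<zero> \<in> grade M d"
  by (rule additive_subgroup.zero_closed[OF grade_subgroup])

lemma add_in_grade: "x \<in> grade M d \<Longrightarrow> y \<in> grade M d \<Longrightarrow> x \<oplus> y \<in> grade M d"
  by (rule additive_subgroup.a_closed[OF grade_subgroup])

lemma uminus_in_grade: "x \<in> grade M d \<Longrightarrow> \<ominus> x \<in> grade M d"
  using subgroup.m_inv_closed[OF additive_subgroup.a_subgroup[OF grade_subgroup]]
  by (simp add: a_inv_def)

lemma finsum_in_grade:
  assumes "finite A" "\<And>a. a \<in> A \<Longrightarrow> f a \<in> grade M d"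
  shows "finsum M f A \<in> grade M d"
  using assms
proof (induction A rule: finite_induct)
  case (insert a A)
  then show ?case
    by (subst finsum_insert) (auto intro: add_in_grade grade_closed)
qed (simp add: zero_in_grade)

lemma ract_zero_left:
  assumes "r \<in> carrier (ext_alg n)"
  shows "\<zero> \<triangleleft> r = \<zero>"
proof -
  have "\<zero> \<triangleleft> r \<oplus> \<zero> \<triangleleft> r = \<zero> \<triangleleft> r"
    using ract_add_left[of \<zero> \<zero> r] assms by simp
  then show ?thesis
    using assms add.l_cancel_one[of "\<zero> \<triangleleft> r" "\<zero> \<triangleleft> r"] by (simp add: ract_closed)
qed

lemma ract_zero_right:
  assumes "x \<in> carrier M"
  shows "x \<triangleleft> 0 = \<zero>"
proof -
  have z: "0 \<in> carrier (ext_alg n :: 'k ext ring)" by (simp add: ext_carrier_iff)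
  have "x \<triangleleft> 0 \<oplus> x \<triangleleft> 0 = x \<triangleleft> 0"
    using ract_add_right[of x 0 0] assms z by simp
  then show ?thesis
    using assms z add.l_cancel_one[of "x \<triangleleft> 0" "x \<triangleleft> 0"] by (simp add: ract_closed)
qed

lemma ract_finsum:
  assumes "finite A" "\<And>a. a \<in> A \<Longrightarrow> f a \<in> carrier M" "r \<in> carrier (ext_alg n)"
  shows "finsum M f A \<triangleleft> r = finsum M (\<lambda>a. f a \<triangleleft> r) A"
  using assms
proof (induction A rule: finite_induct)
  case (insert a A)
  then have "finsum M f (insert a A) \<triangleleft> r = (f a \<oplus> finsum M f A) \<triangleleft> r"
    by (subst finsum_insert) auto
  also have "\<dots> = f a \<triangleleft> r \<oplus> finsum M f A \<triangleleft> r"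
    using insert by (intro ract_add_left) auto
  also have "\<dots> = finsum M (\<lambda>a. f a \<triangleleft> r) (insert a A)"
    using insert by (subst finsum_insert) (auto intro: ract_closed)
  finally show ?case .
qed (simp add: ract_zero_left)

lemma ract_uminus:
  assumes "x \<in> carrier M" "r \<in> carrier (ext_alg n)"
  shows "(\<ominus> x) \<triangleleft> r = \<ominus> (x \<triangleleft> r)"
proof -
  have "(\<ominus> x) \<triangleleft> r \<oplus> x \<triangleleft> r = \<zero>"
    using assms by (simp add: l_neg ract_zero_left flip: ract_add_left)
  then show ?thesis using assms by (simp add: minus_equality ract_closed)
qed

end

lemma graded_hom_closed: "f \<in> graded_hom n L N \<Longrightarrow> x \<in> carrier L \<Longrightarrow> f x \<in> carrier N"
  by (auto simp: graded_hom_def)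

lemma graded_hom_add_apply:
  "f \<in> graded_hom n L N \<Longrightarrow> x \<in> carrier L \<Longrightarrow> y \<in> carrier L \<Longrightarrow> f (x \<oplus>\<^bsub>L\<^esub> y) = f x \<oplus>\<^bsub>N\<^esub> f y"
  by (auto simp: graded_hom_def)

lemma graded_hom_ract:
  "f \<in> graded_hom n L N \<Longrightarrow> x \<in> carrier L \<Longrightarrow> r \<in> carrier (ext_alg n) \<Longrightarrow>
    f (x \<triangleleft>\<^bsub>L\<^esub> r) = f x \<triangleleft>\<^bsub>N\<^esub> r"
  by (auto simp: graded_hom_def)

lemma graded_hom_grade: "f \<in> graded_hom n L N \<Longrightarrow> x \<in> grade L d \<Longrightarrow> f x \<in> grade N d"
  unfolding graded_hom_def by blast

lemma graded_hom_zero_apply: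
  assumes "graded_rmodule n L" "graded_rmodule n N" "f \<in> graded_hom n L N"
  shows "f \<zero>\<^bsub>L\<^esub> = \<zero>\<^bsub>N\<^esub>"
proof -
  interpret L: graded_rmodule n L by fact
  interpret N: graded_rmodule n N by fact
  have "f \<zero>\<^bsub>L\<^esub> \<oplus>\<^bsub>N\<^esub> f \<zero>\<^bsub>L\<^esub> = f \<zero>\<^bsub>L\<^esub>"
    using graded_hom_add_apply[OF assms(3), of "\<zero>\<^bsub>L\<^esub>" "\<zero>\<^bsub>L\<^esub>"] by simp
  then show ?thesis
    using graded_hom_closed[OF assms(3), of "\<zero>\<^bsub>L\<^esub>"] N.add.l_cancel_one by simp
qed

lemma graded_hom_finsum:
  assumes "graded_rmodule n L" "graded_rmodule n N" "f \<in> graded_hom n L N"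
    and "finite A" "\<And>a. a \<in> A \<Longrightarrow> g a \<in> carrier L"
  shows "f (finsum L g A) = finsum N (\<lambda>a. f (g a)) A"
proof -
  interpret L: graded_rmodule n L by fact
  interpret N: graded_rmodule n N by fact
  show ?thesis using assms(4,5)
  proof (induction A rule: finite_induct)
    case empty
    then show ?case using graded_hom_zero_apply[OF assms(1-3)] by simp
  next
    case (insert a A)
    have "f (finsum L g (insert a A)) = f (g a \<oplus>\<^bsub>L\<^esub> finsum L g A)"
      using insert by (subst L.finsum_insert) auto
    also have "\<dots> = f (g a) \<oplus>\<^bsub>N\<^esub> f (finsum L g A)"
      using insert by (intro graded_hom_add_apply[OF assms(3)]) (auto intro: L.finsum_closed)
    also have "\<dots> = finsum N (\<lambda>a. f (g a)) (insert a A)"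
      using insert graded_hom_closed[OF assms(3)] by (subst N.finsum_insert) auto
    finally show ?case .
  qed
qed

lemma graded_hom_compose:
  assumes "graded_rmodule n L" "f \<in> graded_hom n L M" "g \<in> graded_hom n M N"
  shows "compose (carrier L) g f \<in> graded_hom n L N"
proof -
  interpret L: graded_rmodule n L by fact
  show ?thesis
    using assms(2,3) graded_hom_closed[OF assms(2)] graded_hom_grade[OF assms(2)]
      graded_hom_grade[OF assms(3)]
    unfolding graded_hom_def[of n L N]
    by (auto simp: compose_def L.ract_closed L.grade_closed graded_hom_add_apply graded_hom_ract
        graded_hom_closed)
qed

lemma graded_hom_id:
  assumes "graded_rmodule n L"
  shows "(\<lambda>x\<in>carrier L. x) \<in> graded_hom n L L"
proof -
  interpret L: graded_rmodule n L by fact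
  show ?thesis by (auto simp: graded_hom_def L.ract_closed L.grade_closed)
qed

lemma graded_hom_zero:
  assumes "graded_rmodule n L" "graded_rmodule n N"
  shows "(\<lambda>x\<in>carrier L. \<zero>\<^bsub>N\<^esub>) \<in> graded_hom n L N"
proof -
  interpret L: graded_rmodule n L by fact
  interpret N: graded_rmodule n N by fact
  show ?thesis
    by (auto simp: graded_hom_def L.ract_closed L.grade_closed N.ract_zero_left N.zero_in_grade)
qed

lemma graded_hom_add:
  assumes "graded_rmodule n L" "graded_rmodule n N" "f \<in> graded_hom n L N" "g \<in> graded_hom n L N"
  shows "(\<lambda>x\<in>carrier L. f x \<oplus>\<^bsub>N\<^esub> g x) \<in> graded_hom n L N"
proof -
  interpret L: graded_rmodule n L by fact
  interpret N: graded_rmodule n N by fact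
  note cl = graded_hom_closed[OF assms(3)] graded_hom_closed[OF assms(4)]
  show ?thesis
    unfolding graded_hom_def
    using cl
    by (auto simp: L.ract_closed L.grade_closed N.ract_add_left graded_hom_ract[OF assms(3)]
        graded_hom_ract[OF assms(4)] graded_hom_add_apply[OF assms(3)] graded_hom_add_apply[OF assms(4)]
        N.a_ac graded_hom_grade[OF assms(3)] graded_hom_grade[OF assms(4)] intro!: N.add_in_grade)
qed

lemma graded_hom_uminus:
  assumes "graded_rmodule n L" "graded_rmodule n N" "f \<in> graded_hom n L N"
  shows "(\<lambda>x\<in>carrier L. \<ominus>\<^bsub>N\<^esub> f x) \<in> graded_hom n L N"
proof -
  interpret L: graded_rmodule n L by fact
  interpret N: graded_rmodule n N by fact
  note cl = graded_hom_closed[OF assms(3)]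
  show ?thesis
    unfolding graded_hom_def
    using cl
    by (auto simp: L.ract_closed L.grade_closed N.ract_uminus graded_hom_ract[OF assms(3)]
        graded_hom_add_apply[OF assms(3)] N.minus_add graded_hom_grade[OF assms(3)]
        intro!: N.uminus_in_grade)
qed

text \<open>The component of degree \<open>d\<close> of any preimage will do: the images of the
  components of \<open>y\<close> decompose \<open>f y\<close>, which is already homogeneous, and
  decompositions are unique. This is what allows lifts to be chosen of degree zero.\<close>

lemma homogeneous_preimage:
  assumes "graded_rmodule n L" "graded_rmodule n N" "f \<in> graded_hom n L N"
    and "y \<in> carrier L" "f y \<in> grade N d"
  obtains x where "x \<in> grade L d" "f x = f y"
proof -
  interpret L: graded_rmodule n L by fact
  interpret N: graded_rmodule n N by fact
  note hom = graded_hom_closed[OF assms(3)] graded_hom_grade[OF assms(3)]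
    graded_hom_zero_apply[OF assms(1-3)]
  obtain c where c: "\<And>e. c e \<in> grade L e" "finite {e. c e \<noteq> \<zero>\<^bsub>L\<^esub>}"
      "y = finsum L c {e. c e \<noteq> \<zero>\<^bsub>L\<^esub>}"
    using ex1_implies_ex[OF L.grade_decomposition[OF assms(4)]] by blast
  define c1 where "c1 e = f (c e)" for e
  define c2 where "c2 e = (if e = d then f y else \<zero>\<^bsub>N\<^esub>)" for e
  have sub: "{e. c1 e \<noteq> \<zero>\<^bsub>N\<^esub>} \<subseteq> {e. c e \<noteq> \<zero>\<^bsub>L\<^esub>}" using hom by (auto simp: c1_def)
  have "f y = finsum N c1 {e. c e \<noteq> \<zero>\<^bsub>L\<^esub>}"
    unfolding c1_def c(3) using c L.grade_closed by (intro graded_hom_finsum[OF assms(1-3)]) auto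
  also have "\<dots> = finsum N c1 {e. c1 e \<noteq> \<zero>\<^bsub>N\<^esub>}"
    using sub c hom L.grade_closed by (intro N.add.finprod_mono_neutral_cong_right) (auto simp: c1_def intro!: hom(1) L.grade_closed)
  finally have 1: "f y = finsum N c1 {e. c1 e \<noteq> \<zero>\<^bsub>N\<^esub>}" .
  have 2: "f y = finsum N c2 {e. c2 e \<noteq> \<zero>\<^bsub>N\<^esub>}"
  proof (cases "f y = \<zero>\<^bsub>N\<^esub>")
    case False
    then have "{e. c2 e \<noteq> \<zero>\<^bsub>N\<^esub>} = {d}" by (auto simp: c2_def)
    then show ?thesis using hom assms(4) by (simp add: c2_def)
  qed (simp add: c2_def)
  have "finite {e. c2 e \<noteq> \<zero>\<^bsub>N\<^esub>}" by (rule finite_subset[of _ "{d}"]) (auto simp: c2_def)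
  then have "c1 = c2"
    using N.grade_decomposition[OF hom(1)[OF assms(4)]] 1 2 c(1) hom(2) finite_subset[OF sub c(2)]
      assms(5) N.zero_in_grade
    by (elim ex1E) (metis (no_types, lifting) c1_def c2_def)
  then have "f (c d) = f y" by (auto simp: c1_def c2_def fun_eq_iff)
  then show ?thesis using that c(1) by blast
qed

section \<open>Bases and projectivity of graded free modules\<close>

definition fbasis :: "nat \<Rightarrow> ('k :: field) free_vec" where
  "fbasis i = (\<lambda>j S. if j = i \<and> S = {} then 1 else 0)"

lemma fbasis_grade: "i < length ds \<Longrightarrow> fbasis i \<in> grade (graded_free n ds) (ds ! i)"
  by (auto simp: free_grade_iff fbasis_def)

lemma fbasis_closed: "i < length ds \<Longrightarrow> fbasis i \<in> carrier (graded_free n ds)"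
  by (metis fbasis_grade free_grade_closed)

lemma free_expand:
  fixes v :: "('k :: field) free_vec"
  assumes "v \<in> carrier (graded_free n ds)"
  shows "v = (\<Sum>i<length ds. (\<lambda>j. ext_mul (fbasis i j) (v i)))"
proof (intro ext)
  fix j S
  have "ext_mul (fbasis i j) (v i) S = (if i = j then v i S else 0)" for i
  proof (cases "i = j")
    case True
    then have "fbasis i j = (\<lambda>S. if S = {} then 1 else (0 :: 'k))" by (auto simp: fbasis_def)
    then show ?thesis using True ext_mul_one_left[OF free_coord_closed[OF assms]] by simp
  next
    case False
    then have "fbasis i j = (0 :: 'k ext)" by (auto simp: fbasis_def fun_eq_iff)
    then show ?thesis using False by simp
  qed
  then have "(\<Sum>i<length ds. (\<lambda>j. ext_mul (fbasis i j) (v i))) j S =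
      (\<Sum>i<length ds. if i = j then v i S else 0)"
    by (simp add: sum_fun_apply)
  also have "\<dots> = v j S" using assms by (auto simp: free_carrier_iff)
  finally show "v j S = (\<Sum>i<length ds. (\<lambda>j. ext_mul (fbasis i j) (v i))) j S" ..
qed

lemma hom_free_expand:
  assumes "graded_rmodule n N" "f \<in> graded_hom n (graded_free n ds) N"
    and "v \<in> carrier (graded_free n ds)"
  shows "f v = (\<Oplus>\<^bsub>N\<^esub>i\<in>{..<length ds}. f (fbasis i) \<triangleleft>\<^bsub>N\<^esub> v i)"
proof -
  interpret N: graded_rmodule n N by fact
  let ?F = "graded_free n ds"
  interpret F: graded_rmodule n ?F by (rule free_graded_rmodule)
  have cl: "fbasis i \<triangleleft>\<^bsub>?F\<^esub> v i \<in> carrier ?F" if "i < length ds" for i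
    using that by (intro F.ract_closed fbasis_closed free_coord_closed[OF assms(3)])
  have "v = finsum ?F (\<lambda>i. fbasis i \<triangleleft>\<^bsub>?F\<^esub> v i) {..<length ds}"
    using free_expand[OF assms(3)] cl by (subst free_finsum) auto
  then have "f v = f (finsum ?F (\<lambda>i. fbasis i \<triangleleft>\<^bsub>?F\<^esub> v i) {..<length ds})" by simp
  also have "\<dots> = finsum N (\<lambda>i. f (fbasis i \<triangleleft>\<^bsub>?F\<^esub> v i)) {..<length ds}"
    using cl by (intro graded_hom_finsum[OF free_graded_rmodule assms(1,2)]) auto
  also have "\<dots> = finsum N (\<lambda>i. f (fbasis i) \<triangleleft>\<^bsub>N\<^esub> v i) {..<length ds}"
  proof (intro N.finsum_cong')
    show "(\<lambda>i. f (fbasis i) \<triangleleft>\<^bsub>N\<^esub> v i) \<in> {..<length ds} \<rightarrow> carrier N"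
      using graded_hom_closed[OF assms(2)] fbasis_closed free_coord_closed[OF assms(3)]
      by (auto intro!: N.ract_closed)
  qed (use graded_hom_ract[OF assms(2) fbasis_closed free_coord_closed[OF assms(3)]] in auto)
  finally show ?thesis .
qed

lemma hom_free_eqI:
  assumes "graded_rmodule n N" "f \<in> graded_hom n (graded_free n ds) N" "g \<in> graded_hom n (graded_free n ds) N"
    and "\<And>i. i < length ds \<Longrightarrow> f (fbasis i) = g (fbasis i)"
    and "v \<in> carrier (graded_free n ds)"
  shows "f v = g v"
proof -
  interpret N: graded_rmodule n N by fact
  show ?thesis
    unfolding hom_free_expand[OF assms(1,2,5)] hom_free_expand[OF assms(1,3,5)]
    using graded_hom_closed[OF assms(3)] fbasis_closed free_coord_closed[OF assms(5)]
    by (intro N.finsum_cong') (auto intro!: N.ract_closed simp: assms(4))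
qed

lemma free_hom_exists:
  fixes N :: "('k :: field, 'p) graded_rmod"
  assumes "graded_rmodule n N" "\<And>i. i < length ds \<Longrightarrow> m i \<in> grade N (ds ! i)"
  obtains f where "f \<in> graded_hom n (graded_free n ds) N"
    "\<And>i. i < length ds \<Longrightarrow> f (fbasis i) = m i"
proof -
  interpret N: graded_rmodule n N by fact
  let ?F = "graded_free n ds :: ('k, _) graded_rmod"
  interpret F: graded_rmodule n ?F by (rule free_graded_rmodule)
  define f where "f = (\<lambda>v\<in>carrier ?F. \<Oplus>\<^bsub>N\<^esub>i\<in>{..<length ds}. m i \<triangleleft>\<^bsub>N\<^esub> v i)"
  have m: "m i \<in> carrier N" if "i < length ds" for i using N.grade_closed assms(2) that by blast
  have mv: "m i \<triangleleft>\<^bsub>N\<^esub> v i \<in> carrier N" if "i < length ds" "v \<in> carrier ?F" for i v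
    using m that free_coord_closed by (intro N.ract_closed) auto
  have "f \<in> graded_hom n ?F N"
    unfolding graded_hom_def
  proof (intro CollectI conjI ballI allI)
    show "f \<in> carrier ?F \<rightarrow>\<^sub>E carrier N" using mv by (auto simp: f_def)
  next
    fix x y :: "'k free_vec" assume xy: "x \<in> carrier ?F" "y \<in> carrier ?F"
    have "f (x \<oplus>\<^bsub>?F\<^esub> y) = (\<Oplus>\<^bsub>N\<^esub>i\<in>{..<length ds}. (m i \<triangleleft>\<^bsub>N\<^esub> x i \<oplus>\<^bsub>N\<^esub> m i \<triangleleft>\<^bsub>N\<^esub> y i))"
    proof -
      have "m i \<triangleleft>\<^bsub>N\<^esub> (x + y) i = m i \<triangleleft>\<^bsub>N\<^esub> x i \<oplus>\<^bsub>N\<^esub> m i \<triangleleft>\<^bsub>N\<^esub> y i" if "i < length ds" for i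
        using N.ract_add_right[OF m[OF that] free_coord_closed[OF xy(1)] free_coord_closed[OF xy(2)]]
        by simp
      moreover have "f (x \<oplus>\<^bsub>?F\<^esub> y) = (\<Oplus>\<^bsub>N\<^esub>i\<in>{..<length ds}. m i \<triangleleft>\<^bsub>N\<^esub> (x + y) i)"
        using xy by (simp add: f_def free_add_closed)
      moreover have "m i \<triangleleft>\<^bsub>N\<^esub> x i \<oplus>\<^bsub>N\<^esub> m i \<triangleleft>\<^bsub>N\<^esub> y i \<in> carrier N" if "i < length ds" for i
        using mv that xy by simp
      ultimately show ?thesis by (metis (no_types, lifting) N.finsum_cong' Pi_I lessThan_iff)
    qed
    also have "\<dots> = f x \<oplus>\<^bsub>N\<^esub> f y" using xy mv by (auto simp: f_def intro!: N.finsum_addf)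
    finally show "f (x \<oplus>\<^bsub>?F\<^esub> y) = f x \<oplus>\<^bsub>N\<^esub> f y" .
  next
    fix x and r :: "'k ext" assume x: "x \<in> carrier ?F" and r: "r \<in> carrier (ext_alg n)"
    have "f x \<triangleleft>\<^bsub>N\<^esub> r = (\<Oplus>\<^bsub>N\<^esub>i\<in>{..<length ds}. m i \<triangleleft>\<^bsub>N\<^esub> x i \<triangleleft>\<^bsub>N\<^esub> r)"
      unfolding f_def using x mv r by (auto intro!: N.ract_finsum)
    also have "\<dots> = f (x \<triangleleft>\<^bsub>?F\<^esub> r)"
      unfolding f_def using x mv r m F.ract_closed[OF x r] N.ract_mult[OF m free_coord_closed[OF x] r]
      by (auto intro!: N.finsum_cong' N.ract_closed free_coord_closed ext_mul_closed)
    finally show "f (x \<triangleleft>\<^bsub>?F\<^esub> r) = f x \<triangleleft>\<^bsub>N\<^esub> r" ..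
  next
    fix d show "f ` grade ?F d \<subseteq> grade N d"
    proof
      fix y assume "y \<in> f ` grade ?F d"
      then obtain v where v: "v \<in> grade ?F d" "y = f v" by auto
      then have "v i \<in> ext_grade n (d - ds ! i)" for i by (auto simp: free_grade_iff ext_grade_iff)
      then have "m i \<triangleleft>\<^bsub>N\<^esub> v i \<in> grade N d" if "i < length ds" for i
        using N.grade_ract[OF assms(2)[OF that], of "v i" "d - ds ! i"] by simp
      then show "y \<in> grade N d"
        using v by (auto simp: f_def free_grade_closed intro!: N.finsum_in_grade)
    qed
  qed
  moreover have "f (fbasis k) = m k" if k: "k < length ds" for k
  proof -
    have "m i \<triangleleft>\<^bsub>N\<^esub> fbasis k i = (if k = i then m i else \<zero>\<^bsub>N\<^esub>)" if "i < length ds" for i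
    proof (cases "k = i")
      case True
      then have "fbasis k i = (\<one>\<^bsub>ext_alg n\<^esub> :: 'k ext)" by (auto simp: fbasis_def)
      then show ?thesis using True N.ract_one m that by metis
    next
      case False
      then have "fbasis k i = (0 :: 'k ext)" by (auto simp: fbasis_def fun_eq_iff)
      then show ?thesis using False N.ract_zero_right m that by simp
    qed
    then have "f (fbasis k) = (\<Oplus>\<^bsub>N\<^esub>i\<in>{..<length ds}. if k = i then m i else \<zero>\<^bsub>N\<^esub>)"
      unfolding f_def using fbasis_closed[OF k] m by (auto intro!: N.finsum_cong')
    then show ?thesis using k m by (simp add: N.finsum_singleton)
  qed
  ultimately show ?thesis using that by blast
qed

text \<open>Projectivity of graded free modules: homogeneous preimages of the images of the basis
  elements determine the lift, and equality is tested on the basis.\<close>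

lemma free_lift:
  fixes L :: "('k :: field, 'p) graded_rmod" and N :: "('k, 'q) graded_rmod"
  assumes "graded_rmodule n L" "graded_rmodule n N" "f \<in> graded_hom n L N"
    and "g \<in> graded_hom n (graded_free n ds) N"
    and "\<And>x. x \<in> carrier (graded_free n ds) \<Longrightarrow> g x \<in> f ` carrier L"
  obtains h where "h \<in> graded_hom n (graded_free n ds) L"
    "\<And>x. x \<in> carrier (graded_free n ds) \<Longrightarrow> f (h x) = g x"
proof -
  let ?F = "graded_free n ds :: ('k, _) graded_rmod"
  have "\<exists>x\<in>grade L (ds ! i). f x = g (fbasis i)" if i: "i < length ds" for i
  proof -
    obtain y where y: "y \<in> carrier L" "f y = g (fbasis i)" using assms(5)[OF fbasis_closed[OF i]] by (metis imageE)
    have "g (fbasis i) \<in> grade N (ds ! i)" by (rule graded_hom_grade[OF assms(4) fbasis_grade[OF i]])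
    then show ?thesis using y(2) homogeneous_preimage[OF assms(1-3) y(1)] by metis
  qed
  then obtain m where m: "\<And>i. i < length ds \<Longrightarrow> m i \<in> grade L (ds ! i)"
      "\<And>i. i < length ds \<Longrightarrow> f (m i) = g (fbasis i)" by metis
  obtain h where h: "h \<in> graded_hom n ?F L" "\<And>i. i < length ds \<Longrightarrow> h (fbasis i) = m i"
    using free_hom_exists[OF assms(1) m(1)] by blast
  have "f (h x) = g x" if x: "x \<in> carrier ?F" for x
  proof -
    have "compose (carrier ?F) f h x = g x"
    proof (rule hom_free_eqI[OF assms(2) _ assms(4) _ x])
      show "compose (carrier ?F) f h \<in> graded_hom n ?F N"
        by (rule graded_hom_compose[OF free_graded_rmodule h(1) assms(3)])
    qed (simp add: compose_eq fbasis_closed h m)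
    then show ?thesis using x by (simp add: compose_eq)
  qed
  then show ?thesis using that h(1) by blast
qed

section \<open>Comparison of free resolutions\<close>

text \<open>Gaussian elimination with pivot \<open>a i0 j0\<close>. All dimension counts below go
  through it: the comparison of ranks, the growth of the Betti numbers and the relation between
  monomials.\<close>

lemma underdetermined_solution:
  fixes a :: "'i \<Rightarrow> 'j \<Rightarrow> 'k :: field"
  assumes "finite I" "finite J" "card I < card J"
  shows "\<exists>x. (\<exists>j\<in>J. x j \<noteq> 0) \<and> (\<forall>i\<in>I. (\<Sum>j\<in>J. a i j * x j) = 0)"
  using assms
proof (induction I arbitrary: J a rule: finite_induct)
  case empty
  then obtain j where "j \<in> J" by fastforce
  then show ?case by (intro exI[of _ "\<lambda>_. 1"]) auto
next
  case (insert i0 I)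
  show ?case
  proof (cases "\<forall>j\<in>J. a i0 j = 0")
    case True
    obtain x where "\<exists>j\<in>J. x j \<noteq> 0" "\<forall>i\<in>I. (\<Sum>j\<in>J. a i j * x j) = 0"
      using insert.IH[of J a] insert.prems insert.hyps by auto
    then show ?thesis using True by (intro exI[of _ x]) auto
  next
    case False
    then obtain j0 where j0: "j0 \<in> J" "a i0 j0 \<noteq> 0" by blast
    define J' where "J' = J - {j0}"
    have J': "finite J'" "J = insert j0 J'" "j0 \<notin> J'" using j0 insert.prems by (auto simp: J'_def)
    obtain x where x: "\<exists>j\<in>J'. x j \<noteq> 0"
        "\<forall>i\<in>I. (\<Sum>j\<in>J'. (a i j - a i j0 * a i0 j / a i0 j0) * x j) = 0"
      using insert.IH[of J' "\<lambda>i j. a i j - a i j0 * a i0 j / a i0 j0"] insert.prems insert.hyps J'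
      by auto
    \<comment> \<open>The value of the pivot unknown that solves equation \<open>i0\<close>; the
      other equations were already reduced by multiples of it.\<close>
    define t where "t = - (\<Sum>j\<in>J'. a i0 j * x j) / a i0 j0"
    have split: "(\<Sum>j\<in>J. a i j * (x(j0 := t)) j) = a i j0 * t + (\<Sum>j\<in>J'. a i j * x j)" for i
    proof -
      have "(\<Sum>j\<in>J'. a i j * (x(j0 := t)) j) = (\<Sum>j\<in>J'. a i j * x j)"
        using J' by (intro sum.cong) auto
      then show ?thesis unfolding J'(2) using J' by simp
    qed
    have "(\<Sum>j\<in>J. a i j * (x(j0 := t)) j) = 0" if "i \<in> I" for i
    proof -
      have "0 = (\<Sum>j\<in>J'. a i j * x j - a i j0 / a i0 j0 * (a i0 j * x j))"
        using x(2) that by (simp add: left_diff_distrib mult.assoc)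
      also have "\<dots> = (\<Sum>j\<in>J'. a i j * x j) - a i j0 / a i0 j0 * (\<Sum>j\<in>J'. a i0 j * x j)"
        by (simp add: sum_subtractf sum_distrib_left)
      finally show ?thesis unfolding split by (simp add: t_def)
    qed
    moreover have "(\<Sum>j\<in>J. a i0 j * (x(j0 := t)) j) = 0"
      unfolding split using j0 by (simp add: t_def)
    moreover have "\<exists>j\<in>J. (x(j0 := t)) j \<noteq> 0" using x(1) J' by auto
    ultimately show ?thesis by (intro exI[of _ "x(j0 := t)"]) auto
  qed
qed

lemma free_a_inv:
  assumes "x \<in> carrier (graded_free n ds)"
  shows "\<ominus>\<^bsub>graded_free n ds\<^esub> x = - x"
proof -
  interpret abelian_group "graded_free n ds" by (rule free_abelian_group)
  show ?thesis using assms by (intro minus_equality) (auto simp: free_uminus_closed)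
qed

lemma free_diff_closed:
  assumes "v \<in> carrier (graded_free n ds)" "w \<in> carrier (graded_free n ds)"
  shows "v - w \<in> carrier (graded_free n ds)"
  using free_add_closed[OF assms(1) free_uminus_closed[OF assms(2)]] by simp

lemma free_hom_add:
  assumes "f \<in> graded_hom n (graded_free n ds) (graded_free n es)"
    and "x \<in> carrier (graded_free n ds)" "y \<in> carrier (graded_free n ds)"
  shows "f (x + y) = f x + f y"
  using graded_hom_add_apply[OF assms] by simp

lemma free_hom_zero:
  assumes "f \<in> graded_hom n (graded_free n ds) (graded_free n es)"
  shows "f 0 = 0"
  using graded_hom_zero_apply[OF free_graded_rmodule free_graded_rmodule assms] by simp

lemma free_hom_diff:
  assumes "f \<in> graded_hom n (graded_free n ds) (graded_free n es)"
    and "x \<in> carrier (graded_free n ds)" "y \<in> carrier (graded_free n ds)"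
  shows "f (x - y) = f x - f y"
  using free_hom_add[OF assms(1) free_diff_closed[OF assms(2,3)] assms(3)] by (simp add: algebra_simps)

lemma graded_hom_free_add:
  assumes "f \<in> graded_hom n (graded_free n ds) (graded_free n es)"
    and "g \<in> graded_hom n (graded_free n ds) (graded_free n es)"
  shows "(\<lambda>x\<in>carrier (graded_free n ds). f x + g x) \<in> graded_hom n (graded_free n ds) (graded_free n es)"
  using graded_hom_add[OF free_graded_rmodule free_graded_rmodule assms] by simp

lemma graded_hom_free_uminus:
  assumes "f \<in> graded_hom n (graded_free n ds) (graded_free n es)"
  shows "(\<lambda>x\<in>carrier (graded_free n ds). - f x) \<in> graded_hom n (graded_free n ds) (graded_free n es)"
proof -
  have "(\<lambda>x\<in>carrier (graded_free n ds). - f x) =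
      (\<lambda>x\<in>carrier (graded_free n ds). \<ominus>\<^bsub>graded_free n es\<^esub> f x)"
    using graded_hom_closed[OF assms] by (intro restrict_ext) (simp add: free_a_inv)
  then show ?thesis using graded_hom_uminus[OF free_graded_rmodule free_graded_rmodule assms] by simp
qed

lemma graded_hom_free_diff:
  assumes "f \<in> graded_hom n (graded_free n ds) (graded_free n es)"
    and "g \<in> graded_hom n (graded_free n ds) (graded_free n es)"
  shows "(\<lambda>x\<in>carrier (graded_free n ds). f x - g x) \<in> graded_hom n (graded_free n ds) (graded_free n es)"
proof -
  have "(\<lambda>x\<in>carrier (graded_free n ds). f x - g x) = (\<lambda>x\<in>carrier (graded_free n ds).
      f x + (\<lambda>x\<in>carrier (graded_free n ds). - g x) x)"
    by (intro restrict_ext) simp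
  then show ?thesis using graded_hom_free_add[OF assms(1) graded_hom_free_uminus[OF assms(2)]] by simp
qed

lemma free_hom_coord:
  assumes "f \<in> graded_hom n (graded_free n ds) (graded_free n es)" "v \<in> carrier (graded_free n ds)"
  shows "f v k S = (\<Sum>l<length ds. ext_mul (f (fbasis l) k) (v l) S)"
proof -
  let ?E = "graded_free n es"
  have "f v = (\<Oplus>\<^bsub>?E\<^esub>l\<in>{..<length ds}. f (fbasis l) \<triangleleft>\<^bsub>?E\<^esub> v l)"
    by (rule hom_free_expand[OF free_graded_rmodule assms])
  also have "\<dots> = (\<Sum>l<length ds. f (fbasis l) \<triangleleft>\<^bsub>?E\<^esub> v l)"
  proof (rule free_finsum)
    fix l assume "l \<in> {..<length ds}"
    then show "f (fbasis l) \<triangleleft>\<^bsub>?E\<^esub> v l \<in> carrier ?E"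
      using graded_hom_closed[OF assms(1) fbasis_closed] free_ract_closed free_coord_closed[OF assms(2)]
      by fastforce
  qed simp
  finally show ?thesis by (simp add: sum_fun_apply)
qed

lemma free_hom_const_coord:
  assumes "f \<in> graded_hom n (graded_free n ds) (graded_free n es)" "v \<in> carrier (graded_free n ds)"
  shows "f v k {} = (\<Sum>l<length ds. f (fbasis l) k {} * v l {})"
  unfolding free_hom_coord[OF assms] by (simp add: ext_mul_def)

section \<open>Chain maps and homotopies between free resolutions\<close>

definition res_cyc :: "nat \<Rightarrow> ('k :: field, 'm) graded_rmod \<Rightarrow> ('k, 'm) resolution \<Rightarrow> nat \<Rightarrow> 'k free_vec set" where
  "res_cyc n M F i = (case i of
     0 \<Rightarrow> a_kernel (res_mod n F 0) M (res_aug F)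
   | Suc j \<Rightarrow> a_kernel (res_mod n F (Suc j)) (res_mod n F j) (res_bdry F j))"

lemma res_mod_graded_rmodule: "graded_rmodule n (res_mod n F i)"
  unfolding res_mod_def by (rule free_graded_rmodule)

lemma res_cyc_0: "x \<in> res_cyc n M F 0 \<longleftrightarrow> x \<in> carrier (res_mod n F 0) \<and> res_aug F x = \<zero>\<^bsub>M\<^esub>"
  by (simp add: res_cyc_def a_kernel_def')

lemma res_cyc_Suc:
  "x \<in> res_cyc n M F (Suc i) \<longleftrightarrow> x \<in> carrier (res_mod n F (Suc i)) \<and> res_bdry F i x = 0"
  by (simp add: res_cyc_def a_kernel_def' res_mod_def)

locale free_res =
  fixes n :: nat and M :: "('k :: field, 'm) graded_rmod" and F :: "('k, 'm) resolution"
  assumes M: "graded_rmodule n M" and F: "free_resolution n M F"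
begin

abbreviation C where "C i \<equiv> carrier (res_mod n F i)"
abbreviation d where "d i \<equiv> res_bdry F i"

lemma bdry_hom: "d i \<in> graded_hom n (res_mod n F (Suc i)) (res_mod n F i)"
  using F by (simp add: free_resolution_def)

lemma bdry_hom_free: "d i \<in> graded_hom n (graded_free n (res_degs F (Suc i))) (graded_free n (res_degs F i))"
  using bdry_hom by (simp add: res_mod_def)

lemma aug_hom: "res_aug F \<in> graded_hom n (res_mod n F 0) M"
  using F by (simp add: free_resolution_def)

text \<open>Exactness in all positions at once: \<open>res_cyc\<close> treats the augmentation as
  the map out of position 0, so that lifting arguments need no case distinction.\<close>

lemma cyc_eq: "res_cyc n M F i = d i ` C (Suc i)"
  using F by (cases i) (auto simp: free_resolution_def res_cyc_def)

lemma bdry_closed: "x \<in> C (Suc i) \<Longrightarrow> d i x \<in> C i"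
  by (rule graded_hom_closed[OF bdry_hom])

lemma bdry_cyc: "x \<in> C (Suc i) \<Longrightarrow> d i x \<in> res_cyc n M F i"
  by (simp add: cyc_eq)

lemma bdry_bdry: "x \<in> C (Suc (Suc i)) \<Longrightarrow> d i (d (Suc i) x) = 0"
  using bdry_cyc[of x "Suc i"] by (simp add: res_cyc_Suc)

lemma aug_bdry: "x \<in> C (Suc 0) \<Longrightarrow> res_aug F (d 0 x) = \<zero>\<^bsub>M\<^esub>"
  using bdry_cyc[of x 0] by (simp add: res_cyc_0)

lemma cyc_closed: "x \<in> res_cyc n M F i \<Longrightarrow> x \<in> C i"
  by (cases i) (auto simp: res_cyc_0 res_cyc_Suc)

lemma lift_bdry:
  fixes G :: "('k, 'q) resolution"
  assumes "g \<in> graded_hom n (res_mod n G j) (res_mod n F i)"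
    and "\<And>x. x \<in> carrier (res_mod n G j) \<Longrightarrow> g x \<in> res_cyc n M F i"
  obtains h where "h \<in> graded_hom n (res_mod n G j) (res_mod n F (Suc i))"
    "\<And>x. x \<in> carrier (res_mod n G j) \<Longrightarrow> d i (h x) = g x"
  using free_lift[OF res_mod_graded_rmodule res_mod_graded_rmodule bdry_hom
      assms(1)[unfolded res_mod_def[of n G j]]] assms(2)
  unfolding cyc_eq res_mod_def[of n G j] by blast

lemma lift_aug:
  fixes G :: "('k, 'q) resolution"
  assumes "g \<in> graded_hom n (res_mod n G j) M"
  obtains h where "h \<in> graded_hom n (res_mod n G j) (res_mod n F 0)"
    "\<And>x. x \<in> carrier (res_mod n G j) \<Longrightarrow> res_aug F (h x) = g x"
proof -
  have "g x \<in> res_aug F ` C 0" if "x \<in> carrier (res_mod n G j)" for x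
    using graded_hom_closed[OF assms that] F by (simp add: free_resolution_def)
  then show ?thesis
    using free_lift[OF res_mod_graded_rmodule M aug_hom assms[unfolded res_mod_def[of n G j]]] that
    unfolding res_mod_def[of n G j] by blast
qed

end

text \<open>The identity of \<open>M\<close> is lifted position by position, each time using that
  the source is free and the target exact.\<close>

lemma comparison_map:
  assumes "free_res n M F" "free_res n M G"
  obtains \<alpha> where "\<And>i. \<alpha> i \<in> graded_hom n (res_mod n F i) (res_mod n G i)"
    and "\<And>i x. x \<in> carrier (res_mod n F (Suc i)) \<Longrightarrow> res_bdry G i (\<alpha> (Suc i) x) = \<alpha> i (res_bdry F i x)"
    and "\<And>x. x \<in> carrier (res_mod n F 0) \<Longrightarrow> res_aug G (\<alpha> 0 x) = res_aug F x"
proof -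
  interpret F: free_res n M F by fact
  interpret G: free_res n M G by fact
  \<comment> \<open>Sending cycles to cycles is the invariant that keeps the construction going: it
    puts the composite with the differential into the image of the next differential, so that the
    next map can be lifted.\<close>
  define P where "P i a \<longleftrightarrow> a \<in> graded_hom n (res_mod n F i) (res_mod n G i) \<and>
      (\<forall>x\<in>res_cyc n M F i. a x \<in> res_cyc n M G i) \<and>
      (i = 0 \<longrightarrow> (\<forall>x\<in>F.C 0. res_aug G (a x) = res_aug F x))" for i a
  have "\<exists>\<alpha>. \<forall>i. P i (\<alpha> i) \<and> (\<forall>x\<in>F.C (Suc i). G.d i (\<alpha> (Suc i) x) = \<alpha> i (F.d i x))"
  proof (rule dependent_nat_choice)
    obtain a where "a \<in> graded_hom n (res_mod n F 0) (res_mod n G 0)"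
        "\<And>x. x \<in> F.C 0 \<Longrightarrow> res_aug G (a x) = res_aug F x"
      using G.lift_aug[OF F.aug_hom] by blast
    then have "P 0 a" using graded_hom_closed[of a] by (auto simp: P_def res_cyc_0)
    then show "\<exists>a. P 0 a" by blast
  next
    fix a i assume "P i a"
    then have a: "a \<in> graded_hom n (res_mod n F i) (res_mod n G i)"
      "\<And>x. x \<in> res_cyc n M F i \<Longrightarrow> a x \<in> res_cyc n M G i" by (auto simp: P_def)
    let ?g = "compose (F.C (Suc i)) a (F.d i)"
    have g: "?g \<in> graded_hom n (res_mod n F (Suc i)) (res_mod n G i)"
      by (rule graded_hom_compose[OF res_mod_graded_rmodule F.bdry_hom a(1)])
    have g_cyc: "?g x \<in> res_cyc n M G i" if "x \<in> F.C (Suc i)" for x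
      using a(2) F.bdry_cyc[OF that] that by (simp add: compose_eq)
    obtain b where b: "b \<in> graded_hom n (res_mod n F (Suc i)) (res_mod n G (Suc i))"
        "\<And>x. x \<in> F.C (Suc i) \<Longrightarrow> G.d i (b x) = ?g x"
      by (rule G.lift_bdry[OF g g_cyc]) (assumption | rule that)+
    have "b x \<in> res_cyc n M G (Suc i)" if "x \<in> res_cyc n M F (Suc i)" for x
    proof -
      have x: "x \<in> F.C (Suc i)" "F.d i x = 0" using that by (auto simp: res_cyc_Suc)
      have "a 0 = 0" using a(1) free_hom_zero unfolding res_mod_def by blast
      then show ?thesis using b(2)[OF x(1)] x graded_hom_closed[OF b(1) x(1)]
        by (simp add: res_cyc_Suc compose_eq)
    qed
    then have "P (Suc i) b" using b(1) by (auto simp: P_def)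
    then show "\<exists>b. P (Suc i) b \<and> (\<forall>x\<in>F.C (Suc i). G.d i (b x) = a (F.d i x))"
      using b(2) by (intro exI[of _ b]) (simp add: compose_eq)
  qed
  then obtain \<alpha> where "\<And>i. P i (\<alpha> i)" "\<And>i x. x \<in> F.C (Suc i) \<Longrightarrow> G.d i (\<alpha> (Suc i) x) = \<alpha> i (F.d i x)"
    by blast
  then show ?thesis by (intro that[of \<alpha>]) (auto simp: P_def)
qed

context free_res
begin

text \<open>The difference \<open>\<alpha> - id\<close> lifts the zero map of \<open>M\<close> and
  is therefore null-homotopic. It will be applied to round trips between two resolutions.\<close>

lemma homotopy_to_id:
  assumes \<alpha>: "\<And>i. \<alpha> i \<in> graded_hom n (res_mod n F i) (res_mod n F i)"
    "\<And>i x. x \<in> C (Suc i) \<Longrightarrow> d i (\<alpha> (Suc i) x) = \<alpha> i (d i x)"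
    "\<And>x. x \<in> C 0 \<Longrightarrow> res_aug F (\<alpha> 0 x) = res_aug F x"
  obtains s where "\<And>i. s i \<in> graded_hom n (res_mod n F i) (res_mod n F (Suc i))"
    "\<And>x. x \<in> C 0 \<Longrightarrow> d 0 (s 0 x) = \<alpha> 0 x - x"
    "\<And>i x. x \<in> C (Suc i) \<Longrightarrow> d (Suc i) (s (Suc i) x) = \<alpha> (Suc i) x - x - s i (d i x)"
proof -
  define \<gamma> where "\<gamma> i = (\<lambda>x\<in>C i. \<alpha> i x - (\<lambda>x\<in>C i. x) x)" for i
  have \<gamma>_hom: "\<gamma> i \<in> graded_hom n (res_mod n F i) (res_mod n F i)" for i
    unfolding \<gamma>_def res_mod_def
    using \<alpha>(1) by (intro graded_hom_free_diff graded_hom_id free_graded_rmodule) (simp add: res_mod_def)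
  have \<gamma>: "\<gamma> i x = \<alpha> i x - x" if "x \<in> C i" for i x using that by (simp add: \<gamma>_def)
  have \<alpha>_cl: "\<alpha> i x \<in> C i" if "x \<in> C i" for i x using graded_hom_closed[OF \<alpha>(1) that] .
  have \<gamma>_d: "d i (\<gamma> (Suc i) x) = \<gamma> i (d i x)" if "x \<in> C (Suc i)" for i x
    using that \<gamma> bdry_closed free_hom_diff[OF bdry_hom_free] \<alpha>_cl \<alpha>(2) by (simp add: res_mod_def)
  \<comment> \<open>For positive \<open>i\<close> the equation is only required on cycles: this
    suffices to make \<open>\<gamma> - s d\<close> take values in cycles at the next position. In
    position 0 it holds everywhere, since \<open>\<gamma> 0\<close> maps into the kernel of the
    augmentation.\<close>
  define P where "P i s \<longleftrightarrow> s \<in> graded_hom n (res_mod n F i) (res_mod n F (Suc i)) \<and>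
      (\<forall>x\<in>res_cyc n M F i. d i (s x) = \<gamma> i x) \<and> (i = 0 \<longrightarrow> (\<forall>x\<in>C 0. d 0 (s x) = \<gamma> 0 x))" for i s
  have "\<exists>s. \<forall>i. P i (s i) \<and> (\<forall>x\<in>C (Suc i). d (Suc i) (s (Suc i) x) = \<gamma> (Suc i) x - s i (d i x))"
  proof (rule dependent_nat_choice)
    have "\<gamma> 0 x \<in> res_cyc n M F 0" if x: "x \<in> C 0" for x
    proof -
      interpret M: graded_rmodule n M by (rule M)
      have "\<alpha> 0 x = \<gamma> 0 x + x" using x \<gamma> by simp
      then have "res_aug F (\<alpha> 0 x) = res_aug F (\<gamma> 0 x) \<oplus>\<^bsub>M\<^esub> res_aug F x"
        using graded_hom_add_apply[OF aug_hom graded_hom_closed[OF \<gamma>_hom x] x] by (simp add: res_mod_def)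
      then show ?thesis
        using x \<alpha>(3)[OF x] graded_hom_closed[OF aug_hom] graded_hom_closed[OF \<gamma>_hom x]
        by (metis M.add.r_cancel_one' res_cyc_0)
    qed
    then obtain s where "s \<in> graded_hom n (res_mod n F 0) (res_mod n F (Suc 0))" "\<And>x. x \<in> C 0 \<Longrightarrow> d 0 (s x) = \<gamma> 0 x"
      using lift_bdry[OF \<gamma>_hom[of 0]] by blast
    then show "\<exists>s. P 0 s" by (auto simp: P_def cyc_closed)
  next
    fix s i assume "P i s"
    then have s: "s \<in> graded_hom n (res_mod n F i) (res_mod n F (Suc i))"
      "\<And>x. x \<in> res_cyc n M F i \<Longrightarrow> d i (s x) = \<gamma> i x" by (auto simp: P_def)
    let ?g = "\<lambda>x\<in>C (Suc i). \<gamma> (Suc i) x - compose (C (Suc i)) s (d i) x"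
    have sd: "compose (C (Suc i)) s (d i) \<in> graded_hom n (res_mod n F (Suc i)) (res_mod n F (Suc i))"
      by (rule graded_hom_compose[OF res_mod_graded_rmodule bdry_hom s(1)])
    have g: "?g \<in> graded_hom n (res_mod n F (Suc i)) (res_mod n F (Suc i))"
      using graded_hom_free_diff \<gamma>_hom[of "Suc i"] sd unfolding res_mod_def by blast
    have g_cyc: "?g x \<in> res_cyc n M F (Suc i)" if x: "x \<in> C (Suc i)" for x
    proof -
      have "s (d i x) \<in> C (Suc i)" by (intro graded_hom_closed[OF s(1)] bdry_closed x)
      moreover have "\<gamma> (Suc i) x \<in> C (Suc i)" by (rule graded_hom_closed[OF \<gamma>_hom x])
      ultimately have "d i (?g x) = d i (\<gamma> (Suc i) x) - d i (s (d i x))"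
        using x free_hom_diff[OF bdry_hom_free] by (simp add: compose_eq res_mod_def)
      also have "\<dots> = 0" using s(2)[OF bdry_cyc[OF x]] \<gamma>_d[OF x] by simp
      finally show ?thesis using graded_hom_closed[OF g x] by (simp add: res_cyc_Suc)
    qed
    obtain t where t: "t \<in> graded_hom n (res_mod n F (Suc i)) (res_mod n F (Suc (Suc i)))"
        "\<And>x. x \<in> C (Suc i) \<Longrightarrow> d (Suc i) (t x) = ?g x"
      by (rule lift_bdry[OF g g_cyc]) (assumption | rule that)+
    then have t2: "d (Suc i) (t x) = \<gamma> (Suc i) x - s (d i x)" if "x \<in> C (Suc i)" for x
      using that by (simp add: compose_eq)
    have "s 0 = 0" using s(1) free_hom_zero unfolding res_mod_def by blast
    then have "P (Suc i) t" using t(1) t2 by (auto simp: P_def res_cyc_Suc)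
    then show "\<exists>t. P (Suc i) t \<and> (\<forall>x\<in>C (Suc i). d (Suc i) (t x) = \<gamma> (Suc i) x - s (d i x))"
      using t2 by blast
  qed
  then obtain s where s: "\<And>i. P i (s i)"
      "\<And>i x. x \<in> C (Suc i) \<Longrightarrow> d (Suc i) (s (Suc i) x) = \<gamma> (Suc i) x - s i (d i x)"
    by blast
  show ?thesis
  proof (rule that)
    show "s i \<in> graded_hom n (res_mod n F i) (res_mod n F (Suc i))" for i using s(1) by (simp add: P_def)
    show "d 0 (s 0 x) = \<alpha> 0 x - x" if "x \<in> C 0" for x
      using s(1)[of 0] \<gamma>[OF that] that by (simp add: P_def)
    show "d (Suc i) (s (Suc i) x) = \<alpha> (Suc i) x - x - s i (d i x)" if "x \<in> C (Suc i)" for i x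
      using s(2)[OF that] \<gamma>[OF that] by simp
  qed
qed

end

section \<open>Minimality, constant terms and Betti numbers\<close>

lemma rsubmodule_const_zero:
  "rsubmodule n {v \<in> carrier (graded_free n ds :: ('k :: field, 'k free_vec) graded_rmod). \<forall>k\<in>K. v k {} = 0}
    (graded_free n ds)"
  (is "rsubmodule n ?N ?F")
  unfolding rsubmodule_def
proof (intro conjI ballI)
  interpret abelian_group ?F by (rule free_abelian_group)
  show "additive_subgroup ?N ?F"
  proof (rule additive_subgroupI, rule group.subgroupI[OF a_group])
    show "?N \<noteq> {}" using free_zero_closed by (auto intro!: exI[of _ 0])
    show "inv\<^bsub>add_monoid ?F\<^esub> a \<in> ?N" if "a \<in> ?N" for a
      using that free_a_inv[of a n ds] free_uminus_closed[of a n ds] by (simp add: a_inv_def)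
  qed (auto simp: free_add_closed)
  fix x and r :: "'k ext" assume "x \<in> ?N" "r \<in> carrier (ext_alg n)"
  then show "x \<triangleleft>\<^bsub>?F\<^esub> r \<in> ?N" by (simp add: free_ract_closed) (simp add: ext_mul_def)
qed

text \<open>Vectors without constant terms form a submodule that contains all products with elements
  of the ideal \<open>(x_0, ..., x_n)\<close>, hence also what these products generate.\<close>

lemma rad_part_free_const:
  fixes v :: "('k :: field) free_vec"
  assumes "v \<in> rad_part n (graded_free n ds)"
  shows "v k {} = 0"
proof -
  let ?F = "graded_free n ds :: ('k, _) graded_rmod" and ?N = "{v \<in> carrier (graded_free n ds). \<forall>k\<in>UNIV. v k {} = (0 :: 'k)}"
  have "{x \<triangleleft>\<^bsub>?F\<^esub> r | x r. x \<in> carrier ?F \<and> r \<in> carrier (ext_alg n) \<and> r {} = 0} \<subseteq> ?N"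
    by (auto simp: free_ract_closed) (simp add: ext_mul_def)
  then have "rad_part n ?F \<subseteq> ?N"
    unfolding rad_part_def rspan_def using rsubmodule_const_zero[of n ds UNIV] by blast
  then show ?thesis using assms by blast
qed

text \<open>If generator \<open>j\<close> had another degree, everything of degree \<open>e\<close>
  would lie in the submodule of vectors whose coordinate \<open>j\<close> has no constant term, and
  \<open>fbasis j\<close> does not.\<close>

lemma generated_in_degree_free:
  assumes "generated_in_degree n e (graded_free n ds :: ('k :: field, 'k free_vec) graded_rmod)" "j < length ds"
  shows "ds ! j = e"
proof (rule ccontr)
  assume neq: "ds ! j \<noteq> e"
  let ?F = "graded_free n ds :: ('k, 'k free_vec) graded_rmod"
  let ?N = "{v \<in> carrier ?F. \<forall>k\<in>{j}. v k {} = 0}"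
  have "v j {} = 0" if "v \<in> grade ?F e" for v
    using that neq unfolding free_grade_iff by (metis card.empty eq_iff_diff_eq_0 of_nat_0)
  then have "grade ?F e \<subseteq> ?N" using free_grade_closed by auto
  then have "carrier ?F \<subseteq> ?N"
    using assms(1) rsubmodule_const_zero[of n ds "{j}"]
    unfolding generated_in_degree_def rspan_def by blast
  then show False using fbasis_closed[OF assms(2), where 'a = 'k and n = n] by (auto simp: fbasis_def)
qed

lemma minimal_imp_free: "minimal_resolution n M F \<Longrightarrow> free_resolution n M F"
  by (simp add: minimal_resolution_def)

lemma minimal_bdry_const:
  assumes "minimal_resolution n M F" "x \<in> carrier (res_mod n F (Suc i))"
  shows "res_bdry F i x k {} = 0"
  using assms unfolding minimal_resolution_def res_mod_def
  by (intro rad_part_free_const[of _ n "res_degs F i"]) auto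

text \<open>The round trip through \<open>G\<close> is homotopic to the identity of
  \<open>F\<close>, and the homotopy terms vanish modulo the radical because \<open>F\<close> is
  minimal. Hence the matrix of constant terms of \<open>\<alpha> i\<close> is injective.\<close>

lemma minimal_rank_le:
  assumes M: "graded_rmodule n M" and F: "minimal_resolution n M F" and G: "free_resolution n M G"
  shows "length (res_degs F i) \<le> length (res_degs G i)"
proof -
  interpret F: free_res n M F using M F by (simp add: free_res_def minimal_resolution_def)
  interpret G: free_res n M G using M G by (simp add: free_res_def)
  obtain \<alpha> where \<alpha>: "\<And>i. \<alpha> i \<in> graded_hom n (res_mod n F i) (res_mod n G i)"
    "\<And>i x. x \<in> F.C (Suc i) \<Longrightarrow> G.d i (\<alpha> (Suc i) x) = \<alpha> i (F.d i x)"
    "\<And>x. x \<in> F.C 0 \<Longrightarrow> res_aug G (\<alpha> 0 x) = res_aug F x"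
    using comparison_map[OF F.free_res_axioms G.free_res_axioms] by blast
  obtain \<beta> where \<beta>: "\<And>i. \<beta> i \<in> graded_hom n (res_mod n G i) (res_mod n F i)"
    "\<And>i x. x \<in> G.C (Suc i) \<Longrightarrow> F.d i (\<beta> (Suc i) x) = \<beta> i (G.d i x)"
    "\<And>x. x \<in> G.C 0 \<Longrightarrow> res_aug F (\<beta> 0 x) = res_aug G x"
    using comparison_map[OF G.free_res_axioms F.free_res_axioms] by blast
  have \<alpha>_cl: "\<alpha> i x \<in> G.C i" if "x \<in> F.C i" for i x using graded_hom_closed[OF \<alpha>(1) that] .
  let ?\<gamma> = "\<lambda>i. compose (F.C i) (\<beta> i) (\<alpha> i)"
  have \<gamma>: "?\<gamma> i \<in> graded_hom n (res_mod n F i) (res_mod n F i)" for i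
    by (rule graded_hom_compose[OF res_mod_graded_rmodule \<alpha>(1) \<beta>(1)])
  have \<gamma>2: "F.d i (?\<gamma> (Suc i) x) = ?\<gamma> i (F.d i x)" if "x \<in> F.C (Suc i)" for i x
    using that \<alpha>(2) \<beta>(2) \<alpha>_cl F.bdry_closed[OF that] by (simp add: compose_eq)
  have \<gamma>3: "res_aug F (?\<gamma> 0 x) = res_aug F x" if "x \<in> F.C 0" for x
    using that \<alpha>(3) \<beta>(3) \<alpha>_cl by (simp add: compose_eq)
  obtain s where s: "\<And>i. s i \<in> graded_hom n (res_mod n F i) (res_mod n F (Suc i))"
    "\<And>x. x \<in> F.C 0 \<Longrightarrow> F.d 0 (s 0 x) = ?\<gamma> 0 x - x"
    "\<And>i x. x \<in> F.C (Suc i) \<Longrightarrow> F.d (Suc i) (s (Suc i) x) = ?\<gamma> (Suc i) x - x - s i (F.d i x)"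
    by (rule F.homotopy_to_id[OF \<gamma> \<gamma>2 \<gamma>3]) (assumption | rule that)+
  \<comment> \<open>Boundaries have no constant terms by minimality. The term \<open>s d\<close> has
    none either, since the constant terms of an image depend only on those of the argument.\<close>
  have const: "\<beta> i (\<alpha> i x) k {} = x k {}" if x: "x \<in> F.C i" for x k
  proof (cases i)
    case 0
    then show ?thesis
      using x s(2)[of x] minimal_bdry_const[OF F graded_hom_closed[OF s(1)], of x 0 k] by (simp add: compose_eq)
  next
    case (Suc j)
    have "s j (F.d j x) k {} = 0"
      using free_hom_const_coord[OF s(1)[of j, unfolded res_mod_def], of "F.d j x" k] x Suc
        F.bdry_closed[of x j] minimal_bdry_const[OF F] by (simp add: res_mod_def)
    moreover have "F.d i (s i x) k {} = 0" by (rule minimal_bdry_const[OF F graded_hom_closed[OF s(1) x]])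
    ultimately show ?thesis using s(3)[of x j] x Suc by (simp add: compose_eq)
  qed
  show ?thesis
  proof (rule ccontr)
    let ?p = "length (res_degs F i)" and ?q = "length (res_degs G i)"
    assume "\<not> ?p \<le> ?q"
    \<comment> \<open>With more columns than rows, some nonzero constant vector is sent by
      \<open>\<alpha> i\<close> to a vector without constant terms; \<open>\<beta> i\<close> cannot
      restore them, against \<open>const\<close>.\<close>
    then obtain c where c: "\<exists>l<?p. c l \<noteq> 0" "\<forall>k<?q. (\<Sum>l<?p. \<alpha> i (fbasis l) k {} * c l) = 0"
      using underdetermined_solution[of "{..<?q}" "{..<?p}" "\<lambda>k l. \<alpha> i (fbasis l) k {}"] by auto
    define v where "v = (\<lambda>l (S :: nat set). if S = {} \<and> l < ?p then c l else 0)"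
    have v: "v \<in> F.C i" by (auto simp: v_def res_mod_def free_carrier_iff)
    have "\<alpha> i v k {} = 0" if "k < ?q" for k
      using free_hom_const_coord[OF \<alpha>(1)[of i, unfolded res_mod_def], of v k] v c that
      by (simp add: res_mod_def) (simp add: v_def)
    then have "\<beta> i (\<alpha> i v) k {} = 0" for k
      using free_hom_const_coord[OF \<beta>(1)[of i, unfolded res_mod_def], of "\<alpha> i v" k] \<alpha>_cl[OF v]
      by (simp add: res_mod_def)
    then have "c l = 0" if "l < ?p" for l using const[OF v, of l] that by (simp add: v_def)
    then show False using c by blast
  qed
qed

lemma betti_eq:
  assumes "graded_rmodule n M" "minimal_resolution n M F"
  shows "betti n M i = length (res_degs F i)"
proof -
  let ?G = "SOME F. minimal_resolution n M F"
  have "minimal_resolution n M ?G" using assms(2) by (rule someI)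
  then show ?thesis
    unfolding betti_def using assms
    by (intro antisym minimal_rank_le[OF assms(1)] minimal_imp_free)
qed

section \<open>Vanishing of Ext^1 read off from any free resolution\<close>

lemma coboundary_transfer:
  assumes N: "graded_rmodule n N" and G: "free_res n M G" and F: "free_res n M F"
    and triv: "\<And>h. h \<in> res_cocycles n G N 1 \<Longrightarrow>
      \<exists>g\<in>graded_hom n (res_mod n G 0) N. \<forall>x\<in>carrier (res_mod n G 1). h x = g (res_bdry G 0 x)"
    and h: "h \<in> res_cocycles n F N 1"
  shows "\<exists>g\<in>graded_hom n (res_mod n F 0) N. \<forall>x\<in>carrier (res_mod n F 1). h x = g (res_bdry F 0 x)"
proof -
  interpret F: free_res n M F by fact
  interpret G: free_res n M G by fact
  interpret N: graded_rmodule n N by fact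
  obtain \<alpha> where \<alpha>: "\<And>i. \<alpha> i \<in> graded_hom n (res_mod n G i) (res_mod n F i)"
    "\<And>i x. x \<in> G.C (Suc i) \<Longrightarrow> F.d i (\<alpha> (Suc i) x) = \<alpha> i (G.d i x)"
    "\<And>x. x \<in> G.C 0 \<Longrightarrow> res_aug F (\<alpha> 0 x) = res_aug G x"
    using comparison_map[OF G.free_res_axioms F.free_res_axioms] by blast
  obtain \<beta> where \<beta>: "\<And>i. \<beta> i \<in> graded_hom n (res_mod n F i) (res_mod n G i)"
    "\<And>i x. x \<in> F.C (Suc i) \<Longrightarrow> G.d i (\<beta> (Suc i) x) = \<beta> i (F.d i x)"
    "\<And>x. x \<in> F.C 0 \<Longrightarrow> res_aug G (\<beta> 0 x) = res_aug F x"
    using comparison_map[OF F.free_res_axioms G.free_res_axioms] by blast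
  have \<alpha>_cl: "\<alpha> i x \<in> F.C i" if "x \<in> G.C i" for i x using graded_hom_closed[OF \<alpha>(1) that] .
  have \<beta>_cl: "\<beta> i x \<in> G.C i" if "x \<in> F.C i" for i x using graded_hom_closed[OF \<beta>(1) that] .
  let ?\<gamma> = "\<lambda>i. compose (F.C i) (\<alpha> i) (\<beta> i)"
  have \<gamma>: "?\<gamma> i \<in> graded_hom n (res_mod n F i) (res_mod n F i)" for i
    by (rule graded_hom_compose[OF res_mod_graded_rmodule \<beta>(1) \<alpha>(1)])
  have \<gamma>2: "F.d i (?\<gamma> (Suc i) x) = ?\<gamma> i (F.d i x)" if "x \<in> F.C (Suc i)" for i x
    using that \<alpha>(2) \<beta>(2) \<beta>_cl F.bdry_closed[OF that] by (simp add: compose_eq)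
  have \<gamma>3: "res_aug F (?\<gamma> 0 x) = res_aug F x" if "x \<in> F.C 0" for x
    using that \<alpha>(3) \<beta>(3) \<beta>_cl by (simp add: compose_eq)
  obtain s where s: "\<And>i. s i \<in> graded_hom n (res_mod n F i) (res_mod n F (Suc i))"
    "\<And>x. x \<in> F.C 0 \<Longrightarrow> F.d 0 (s 0 x) = ?\<gamma> 0 x - x"
    "\<And>i x. x \<in> F.C (Suc i) \<Longrightarrow> F.d (Suc i) (s (Suc i) x) = ?\<gamma> (Suc i) x - x - s i (F.d i x)"
    by (rule F.homotopy_to_id[OF \<gamma> \<gamma>2 \<gamma>3]) (assumption | rule that)+
  have h_hom: "h \<in> graded_hom n (res_mod n F 1) N"
    and h_d: "\<And>x. x \<in> F.C 2 \<Longrightarrow> h (F.d 1 x) = \<zero>\<^bsub>N\<^esub>"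
    using h by (auto simp: res_cocycles_def numeral_2_eq_2)
  note free = res_mod_graded_rmodule
  have "compose (G.C 1) h (\<alpha> 1) \<in> res_cocycles n G N 1"
    unfolding res_cocycles_def
  proof (intro CollectI conjI ballI)
    show "compose (G.C 1) h (\<alpha> 1) \<in> graded_hom n (res_mod n G 1) N"
      by (rule graded_hom_compose[OF free \<alpha>(1) h_hom])
    fix x assume x: "x \<in> G.C (Suc 1)"
    then show "compose (G.C 1) h (\<alpha> 1) (G.d 1 x) = \<zero>\<^bsub>N\<^esub>"
      using h_d[of "\<alpha> 2 x"] \<alpha>(2)[OF x] \<alpha>_cl[OF x] G.bdry_closed[OF x]
      by (simp add: compose_eq numeral_2_eq_2)
  qed
  from triv[OF this] obtain g where g: "g \<in> graded_hom n (res_mod n G 0) N"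
      "\<And>x. x \<in> G.C 1 \<Longrightarrow> h (\<alpha> 1 x) = g (G.d 0 x)" by (auto simp: compose_eq)
  \<comment> \<open>Applying \<open>h\<close> to the homotopy equation gives
    \<open>h = (g \<beta> - h s) d\<close>: the remaining term \<open>h d s\<close> is zero because
    \<open>h\<close> is a cocycle.\<close>
  let ?g1 = "compose (F.C 0) g (\<beta> 0)" and ?g2 = "compose (F.C 0) h (s 0)"
  let ?g2' = "\<lambda>x\<in>F.C 0. \<ominus>\<^bsub>N\<^esub> ?g2 x"
  have g1: "?g1 \<in> graded_hom n (res_mod n F 0) N" by (rule graded_hom_compose[OF free \<beta>(1) g(1)])
  have g2: "?g2 \<in> graded_hom n (res_mod n F 0) N"
    using graded_hom_compose[OF free s(1)] h_hom by simp
  have g2': "?g2' \<in> graded_hom n (res_mod n F 0) N" by (rule graded_hom_uminus[OF free N g2])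
  show ?thesis
  proof (intro bexI ballI)
    show "(\<lambda>x\<in>F.C 0. ?g1 x \<oplus>\<^bsub>N\<^esub> ?g2' x) \<in> graded_hom n (res_mod n F 0) N"
      by (rule graded_hom_add[OF free N g1 g2'])
    fix x assume x: "x \<in> F.C 1"
    have dx: "F.d 0 x \<in> F.C 0" using F.bdry_closed x by simp
    have c: "x \<in> F.C 1" "s 0 (F.d 0 x) \<in> F.C 1" "F.d 1 (s 1 x) \<in> F.C 1"
      using x graded_hom_closed[OF s(1) dx] F.bdry_closed[OF graded_hom_closed[OF s(1) x]] by auto
    have "\<alpha> 1 (\<beta> 1 x) = x + (s 0 (F.d 0 x) + F.d 1 (s 1 x))"
      using s(3)[of x 0] x by (simp add: compose_eq algebra_simps)
    moreover have "s 0 (F.d 0 x) + F.d 1 (s 1 x) \<in> F.C 1" using c by (simp add: res_mod_def free_add_closed)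
    ultimately have "h (\<alpha> 1 (\<beta> 1 x)) = h x \<oplus>\<^bsub>N\<^esub> (h (s 0 (F.d 0 x)) \<oplus>\<^bsub>N\<^esub> h (F.d 1 (s 1 x)))"
      using graded_hom_add_apply[OF h_hom c(1)] graded_hom_add_apply[OF h_hom c(2,3)]
      by (simp add: res_mod_def)
    moreover have "h (F.d 1 (s 1 x)) = \<zero>\<^bsub>N\<^esub>"
      using h_d graded_hom_closed[OF s(1) x] by (simp add: numeral_2_eq_2)
    moreover have "h (\<alpha> 1 (\<beta> 1 x)) = g (\<beta> 0 (F.d 0 x))"
      using g(2) \<beta>_cl[OF x] \<beta>(2)[of x 0] x by simp
    ultimately have "g (\<beta> 0 (F.d 0 x)) = h x \<oplus>\<^bsub>N\<^esub> h (s 0 (F.d 0 x))"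
      using graded_hom_closed[OF h_hom] c by simp
    moreover have "h x \<in> carrier N" "h (s 0 (F.d 0 x)) \<in> carrier N"
      using graded_hom_closed[OF h_hom] c by auto
    ultimately show "h x = (\<lambda>x\<in>F.C 0. ?g1 x \<oplus>\<^bsub>N\<^esub> ?g2' x) (F.d 0 x)"
      using dx by (simp add: compose_eq N.a_assoc N.r_neg)
  qed
qed

text \<open>A cocycle lies in its own coset because the zero map is a coboundary; if the quotient is
  trivial, this coset is the set of coboundaries.\<close>

lemma trivial_cohomology:
  assumes N: "graded_rmodule n N" and F: "free_res n M F"
    and triv: "carrier (res_cohomology n F N 1) = {\<one>\<^bsub>res_cohomology n F N 1\<^esub>}"
    and h: "h \<in> res_cocycles n F N 1"
  shows "\<exists>g\<in>graded_hom n (res_mod n F 0) N. \<forall>x\<in>carrier (res_mod n F 1). h x = g (res_bdry F 0 x)"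
proof -
  interpret F: free_res n M F by fact
  interpret N: graded_rmodule n N by fact
  let ?B = "res_coboundaries n F N 1" and ?G = "(hom_group n (res_mod n F 1) N)\<lparr>carrier := res_cocycles n F N 1\<rparr>"
  let ?z = "\<lambda>x\<in>F.C 0. \<zero>\<^bsub>N\<^esub>"
  have "?z \<in> graded_hom n (res_mod n F 0) N"
    unfolding res_mod_def by (rule graded_hom_zero[OF free_graded_rmodule N])
  then have "compose (F.C 1) ?z (F.d 0) \<in> ?B" by simp
  moreover have "compose (F.C 1) ?z (F.d 0) \<otimes>\<^bsub>?G\<^esub> h = h"
  proof -
    have "h \<in> graded_hom n (res_mod n F 1) N" using h by (simp add: res_cocycles_def)
    then have "h \<in> extensional (F.C 1)" "\<And>x. x \<in> F.C 1 \<Longrightarrow> h x \<in> carrier N"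
      by (auto simp: graded_hom_def PiE_def)
    then show ?thesis
      using F.bdry_closed[of _ 0]
      by (auto simp: hom_group_def compose_def fun_eq_iff extensional_def)
  qed
  ultimately have "h \<in> ?B #>\<^bsub>?G\<^esub> h" unfolding r_coset_def by force
  also have "?B #>\<^bsub>?G\<^esub> h = ?B"
  proof -
    have "?B #>\<^bsub>?G\<^esub> h \<in> carrier (?G Mod ?B)" unfolding carrier_FactGroup using h by auto
    then show ?thesis using triv unfolding res_cohomology_def by simp
  qed
  finally show ?thesis by (auto simp: compose_eq)
qed

text \<open>\<open>Ext\<close> is computed from a resolution picked by \<open>SOME\<close>, whereas
  the argument needs coboundaries on the linear one.\<close>

lemma Ext_1_trivial:
  assumes N: "graded_rmodule n N" and F: "free_res n M F"
    and triv: "carrier (Ext n 1 M N) = {\<one>\<^bsub>Ext n 1 M N\<^esub>}"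
    and h: "h \<in> res_cocycles n F N 1"
  shows "\<exists>g\<in>graded_hom n (res_mod n F 0) N. \<forall>x\<in>carrier (res_mod n F 1). h x = g (res_bdry F 0 x)"
proof -
  let ?G = "SOME F. free_resolution n M F"
  have "free_resolution n M ?G" using F unfolding free_res_def by (blast intro: someI)
  then have G: "free_res n M ?G" using F by (simp add: free_res_def)
  show ?thesis
    using coboundary_transfer[OF N G F _ h] trivial_cohomology[OF N G] triv unfolding Ext_def by blast
qed

section \<open>Commuting operators and their deformations\<close>

definition scl :: "'k :: field \<Rightarrow> (nat \<Rightarrow> 'k) \<Rightarrow> nat \<Rightarrow> 'k" where
  "scl c v = (\<lambda>k. c * v k)"

lemma scl_apply [simp]: "scl c v k = c * v k"
  by (simp add: scl_def)

text \<open>The space \<open>k^r\<close> is modelled inside \<open>nat \<Rightarrow> 'k\<close>, so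
  that the generator spaces of all degrees share one type.\<close>

definition supp_below :: "nat \<Rightarrow> (nat \<Rightarrow> 'k :: field) \<Rightarrow> bool" where
  "supp_below r v \<longleftrightarrow> (\<forall>k. v k \<noteq> 0 \<longrightarrow> k < r)"

lemma supp_below_closed:
  "supp_below r 0" "supp_below r v \<Longrightarrow> supp_below r w \<Longrightarrow> supp_below r (v + w)"
  "supp_below r v \<Longrightarrow> supp_below r (scl c v)"
  unfolding supp_below_def by (auto, metis add.right_neutral)

lemma supp_below_sum: "(\<And>a. a \<in> A \<Longrightarrow> supp_below r (f a)) \<Longrightarrow> supp_below r (sum f A)"
  by (induction A rule: infinite_finite_induct) (auto simp: supp_below_closed)

definition lin :: "((nat \<Rightarrow> 'k :: field) \<Rightarrow> nat \<Rightarrow> 'k) \<Rightarrow> bool" where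
  "lin f \<longleftrightarrow> (\<forall>v w. f (v + w) = f v + f w) \<and> (\<forall>c v. f (scl c v) = scl c (f v))"

lemma lin_add: "lin f \<Longrightarrow> f (v + w) = f v + f w"
  and lin_scl: "lin f \<Longrightarrow> f (scl c v) = scl c (f v)"
  by (auto simp: lin_def)

lemma lin_zero:
  assumes "lin f"
  shows "f 0 = 0"
  using lin_add[OF assms, of 0 0] by simp

lemma lin_sum:
  assumes "lin f"
  shows "f (\<Sum>a\<in>A. g a) = (\<Sum>a\<in>A. f (g a))"
  by (induction A rule: infinite_finite_induct)
    (simp_all add: lin_add[OF assms] lin_zero[OF assms] del: plus_fun_apply zero_fun_apply)

lemma lin_comp: "lin f \<Longrightarrow> lin g \<Longrightarrow> lin (\<lambda>v. f (g v))"
  by (simp add: lin_def)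

definition unit_vec :: "nat \<Rightarrow> nat \<Rightarrow> 'k :: field" where
  "unit_vec l = (\<lambda>k. if k = l then 1 else 0)"

lemma supp_below_unit: "l < r \<Longrightarrow> supp_below r (unit_vec l)"
  by (simp add: supp_below_def unit_vec_def)

lemma unit_expand:
  assumes "supp_below r v"
  shows "v = (\<Sum>l<r. scl (v l) (unit_vec l))"
proof
  fix k
  have "(\<Sum>l<r. scl (v l) (unit_vec l)) k = (\<Sum>l<r. if l = k then v l else 0)"
    unfolding sum_fun_apply by (intro sum.cong) (auto simp: unit_vec_def)
  also have "\<dots> = v k" using assms by (auto simp: supp_below_def)
  finally show "v k = (\<Sum>l<r. scl (v l) (unit_vec l)) k" ..
qed

lemma lin_coord:
  assumes "lin f" "supp_below r v"
  shows "f v k = (\<Sum>l<r. f (unit_vec l) k * v l)"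
proof -
  have "f v = (\<Sum>l<r. scl (v l) (f (unit_vec l)))"
    by (subst unit_expand[OF assms(2)]) (simp add: lin_sum[OF assms(1)] lin_scl[OF assms(1)])
  then show ?thesis by (simp add: sum_fun_apply mult.commute)
qed

lemma scl_add: "scl c (v + w) = scl c v + scl c w"
  and scl_scl: "scl c (scl b v) = scl (c * b) v"
  and scl_zero [simp]: "scl c 0 = 0"
  by (auto simp: fun_eq_iff algebra_simps)

lemma scl_sum: "scl c (\<Sum>a\<in>A. g a) = (\<Sum>a\<in>A. scl c (g a))"
  by (induction A rule: infinite_finite_induct) (simp_all add: scl_add del: plus_fun_apply zero_fun_apply scl_apply)

text \<open>Over a finite field, \<open>\<Prod>(X - a) + 1\<close> takes the value 1 everywhere.
  Infinitely many scalars are needed later to find a point where a given nonzero polynomial does not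
  vanish.\<close>

lemma alg_closed_infinite: "infinite (UNIV :: 'k :: alg_closed_field set)"
proof
  assume fin: "finite (UNIV :: 'k set)"
  let ?p = "(\<Prod>a\<in>UNIV. [:- a, 1:]) + [:1:] :: 'k poly"
  have "degree (\<Prod>a\<in>(UNIV :: 'k set). [:- a, 1:]) = card (UNIV :: 'k set)"
    by (subst degree_prod_eq_sum_degree) auto
  then have "degree ?p > 0"
    using fin by (subst degree_add_eq_left) (auto simp: card_gt_0_iff)
  then obtain x where "poly ?p x = 0" using alg_closed_imp_poly_has_root by blast
  moreover have "poly (\<Prod>a\<in>UNIV. [:- a, 1:]) x = 0" using fin by (auto simp: poly_prod prod_zero_iff)
  ultimately show False by simp
qed

lemma ex_nonroot:
  fixes p :: "'k :: field poly"
  assumes "infinite (UNIV :: 'k set)" "p \<noteq> 0"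
  shows "\<exists>s. poly p s \<noteq> 0"
  using poly_roots_finite[OF assms(2)] assms(1) by (metis (mono_tags, lifting) UNIV_eq_I mem_Collect_eq)

section \<open>Monomials encoded by base q digits\<close>

fun digit_word :: "nat \<Rightarrow> nat \<Rightarrow> nat \<Rightarrow> nat list" where
  "digit_word q 0 m = []"
| "digit_word q (Suc j) m = replicate (m div q ^ j mod q) (Suc j) @ digit_word q j m"

lemma digit_word_set: "set (digit_word q n m) \<subseteq> {..n}"
  by (induction n) (auto split: if_splits)

lemma digit_word_length:
  assumes "q > 0"
  shows "length (digit_word q n m) \<le> n * (q - 1)"
proof (induction n)
  case (Suc n)
  have "m div q ^ n mod q < q" using assms by simp
  then show ?case using Suc by simp
qed simp

text \<open>Kronecker substitution: digit \<open>j\<close> of \<open>m\<close> is the exponent of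
  the variable \<open>j + 1\<close>, so the exponents of \<open>s\<close> add up to the base
  \<open>q\<close> expansion of \<open>m\<close>, and distinct monomials become distinct
  powers.\<close>

lemma digit_word_prod:
  assumes "\<And>j. c (Suc j) = (s :: 'k :: field) ^ (q ^ j)"
  shows "prod_list (map c (digit_word q n m)) = s ^ (m mod q ^ n)"
proof (induction n)
  case (Suc n)
  have "m mod q ^ Suc n = q ^ n * (m div q ^ n mod q) + m mod q ^ n"
    using mod_mult2_eq[of m "q ^ n" q] by (simp add: mult.commute)
  then show ?case using Suc assms by (simp add: power_add power_mult)
qed simp

section \<open>Commuting operators without common kernel\<close>

locale commuting_operators =
  fixes n :: nat and r :: "nat \<Rightarrow> nat" and A :: "nat \<Rightarrow> nat \<Rightarrow> (nat \<Rightarrow> 'k :: field) \<Rightarrow> nat \<Rightarrow> 'k"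
  assumes A_lin: "lin (A i j)"
    and A_supp: "supp_below (r i) (A i j v)"
    and A_commute: "j \<le> n \<Longrightarrow> l \<le> n \<Longrightarrow> A i j (A (Suc i) l v) = A i l (A (Suc i) j v)"
    and A_inj: "supp_below (r (Suc i)) v \<Longrightarrow> (\<And>j. j \<le> n \<Longrightarrow> A i j v = 0) \<Longrightarrow> v = 0"
begin

text \<open>\<open>W i w\<close> leads from V_(i + length w) to V_i. The last letter of the word
  acts first, in the highest degree.\<close>

fun W :: "nat \<Rightarrow> nat list \<Rightarrow> (nat \<Rightarrow> 'k) \<Rightarrow> nat \<Rightarrow> 'k" where
  "W i [] v = v"
| "W i (j # w) v = A i j (W (Suc i) w v)"

lemma W_append: "W i (u @ w) v = W i u (W (i + length u) w v)"
  by (induction u arbitrary: i) auto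

lemma W_lin: "lin (W i w)"
proof (induction w arbitrary: i)
  case (Cons j w)
  then show ?case using lin_comp[OF A_lin Cons] by simp
qed (simp add: lin_def)

lemma W_supp: "supp_below (r (i + length w)) v \<Longrightarrow> supp_below (r i) (W i w v)"
  by (cases w) (auto simp: A_supp)

lemma W_move: "j \<le> n \<Longrightarrow> set u \<subseteq> {..n} \<Longrightarrow> W i (j # u @ w) v = W i (u @ j # w) v"
  by (induction u arbitrary: i) (simp_all add: A_commute[where j = j])

text \<open>By commutation a word acts as a monomial, so only the multiplicities of its letters
  matter.\<close>

lemma W_mset: "mset u = mset w \<Longrightarrow> set w \<subseteq> {..n} \<Longrightarrow> W i u v = W i w v"
proof (induction u arbitrary: i w)
  case (Cons j u)
  have "j \<in> set w" using Cons.prems(1) by (metis list.set_intros(1) set_mset_mset)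
  then obtain w1 w2 where w: "w = w1 @ j # w2" by (meson split_list)
  then have "W i w v = W i (j # w1 @ w2) v" using Cons.prems W_move by simp
  moreover have "W (Suc i) u v = W (Suc i) (w1 @ w2) v" using Cons w by (intro Cons.IH) auto
  ultimately show ?case by simp
qed simp

text \<open>Dual to generation in degree 0 of a module over the polynomial ring:
  \<open>A_inj\<close> says that the dual of V_(i+1) is spanned by the variables applied to the dual
  of V_i, and this is iterated \<open>d\<close> times.\<close>

lemma W_inj:
  assumes "supp_below (r (i + d)) v"
    and "\<And>w. length w = d \<Longrightarrow> set w \<subseteq> {..n} \<Longrightarrow> W i w v = 0"
  shows "v = 0"
  using assms
proof (induction d arbitrary: v)
  case 0
  then show ?case using 0(2)[of "[]"] by simp
next
  case (Suc d)
  show ?case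
  proof (rule A_inj[of "i + d"])
    show "supp_below (r (Suc (i + d))) v" using Suc by simp
    fix j assume j: "j \<le> n"
    show "A (i + d) j v = 0"
    proof (rule Suc.IH[OF A_supp])
      fix w assume w: "length w = d" "set w \<subseteq> {..n}"
      have "W i w (A (i + d) j v) = W i (w @ [j]) v" using w by (simp add: W_append)
      also have "\<dots> = 0" using w j by (intro Suc.prems) auto
      finally show "W i w (A (i + d) j v) = 0" .
    qed
  qed
qed

text \<open>A monomial of degree \<open>i\<close> is one of at most \<open>(i + 1) ^ (n + 1)\<close>
  exponent vectors and has \<open>r 0\<close> coordinates in V_0. If \<open>r i\<close> exceeded the
  product, a nonzero vector would be killed by all words of length \<open>i\<close>. The bound will
  show that the infimum defining the complexity is attained.\<close>

lemma polynomial_growth: "r i \<le> r 0 * (i + 1) ^ (n + 1)"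
proof (rule ccontr)
  assume contra: "\<not> ?thesis"
  define Ex where "Ex = {..n} \<rightarrow>\<^sub>E {..i}"
  define good where "good e w \<longleftrightarrow> set w \<subseteq> {..n} \<and> length w = i \<and> (\<forall>j\<le>n. count (mset w) j = e j)"
    for e :: "nat \<Rightarrow> nat" and w
  \<comment> \<open>One word per exponent vector. If the exponents do not add up to
    \<open>i\<close>, there is no such word and the choice is arbitrary; this only adds equations to
    the system.\<close>
  define wr where "wr e = (SOME w. good e w)" for e
  have "card ({..<r 0} \<times> Ex) = r 0 * (i + 1) ^ (n + 1)"
    by (simp add: Ex_def card_cartesian_product card_PiE)
  moreover have "finite ({..<r 0} \<times> Ex)" by (auto simp: Ex_def intro: finite_PiE)
  ultimately obtain x where x: "\<exists>l\<in>{..<r i}. x l \<noteq> 0"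
      "\<forall>(k, e)\<in>{..<r 0} \<times> Ex. (\<Sum>l<r i. W 0 (wr e) (unit_vec l) k * x l) = 0"
    using underdetermined_solution[of "{..<r 0} \<times> Ex" "{..<r i}"
        "\<lambda>(k, e) l. W 0 (wr e) (unit_vec l) k"] contra
    by (auto simp: not_le split_def)
  define v where "v = (\<lambda>l. if l < r i then x l else 0)"
  have v: "supp_below (r i) v" by (simp add: v_def supp_below_def)
  have "v = 0"
  proof (rule W_inj[of 0 i])
    show "supp_below (r (0 + i)) v" using v by simp
    fix w assume w: "length w = i" "set w \<subseteq> {..n}"
    define e where "e = (\<lambda>j\<in>{..n}. count (mset w) j)"
    have e: "e \<in> Ex" using w count_le_size[of "mset w"] by (auto simp: Ex_def e_def)
    have "good e w" using w by (simp add: good_def e_def)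
    then have wr: "good e (wr e)" unfolding wr_def by (rule someI)
    have "mset (wr e) = mset w"
    proof (rule multiset_eqI)
      fix j
      show "count (mset (wr e)) j = count (mset w) j"
      proof (cases "j \<le> n")
        case False
        then have "j \<notin> set w" "j \<notin> set (wr e)" using w wr by (auto simp: good_def)
        then show ?thesis by (metis count_greater_zero_iff gr_zeroI set_mset_mset)
      qed (use wr in \<open>simp add: good_def e_def\<close>)
    qed
    then have "W 0 w v = W 0 (wr e) v" using w by (metis W_mset)
    also have "\<dots> = 0"
    proof
      fix k
      show "W 0 (wr e) v k = 0 k"
      proof (cases "k < r 0")
        case True
        have "W 0 (wr e) v k = (\<Sum>l<r i. W 0 (wr e) (unit_vec l) k * v l)" by (rule lin_coord[OF W_lin v])
        also have "\<dots> = 0" using x(2) e True by (simp add: v_def)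
        finally show ?thesis by simp
      next
        case False
        have "supp_below (r 0) (W 0 (wr e) v)" using wr v by (intro W_supp) (simp add: good_def)
        then show ?thesis using False by (auto simp: supp_below_def)
      qed
    qed
    finally show "W 0 w v = 0" .
  qed
  then show False using x(1) by (auto simp: v_def fun_eq_iff split: if_splits)
qed

text \<open>Pigeonhole: a word of length at least \<open>(n + 1) * d\<close> repeats some letter
  \<open>d\<close> times. Collecting these letters shows that the word acts as zero.\<close>

lemma eventually_zero_of_nilpotent:
  assumes d: "d > 0" and nil: "\<And>p v. p \<le> n \<Longrightarrow> supp_below (r d) v \<Longrightarrow> W 0 (replicate d p) v = 0"
    and N: "N \<ge> (n + 1) * d"
  shows "r N = 0"
proof (rule ccontr)
  assume "r N \<noteq> 0"
  \<comment> \<open>Nilpotency is given only for maps ending in V_0. A word \<open>u\<close> from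
    V_i to V_0 can be moved past the power of \<open>A p\<close>, and \<open>W_inj\<close> removes
    it again.\<close>
  have nil': "W i (replicate d p) v = 0" if p: "p \<le> n" and v: "supp_below (r (i + d)) v" for i p v
  proof (rule W_inj[of 0 i])
    show "supp_below (r (0 + i)) (W i (replicate d p) v)" using W_supp[of i "replicate d p" v] v by simp
    fix u assume u: "length u = i" "set u \<subseteq> {..n}"
    have "W 0 u (W i (replicate d p) v) = W 0 (u @ replicate d p) v" using u by (simp add: W_append)
    also have "\<dots> = W 0 (replicate d p @ u) v" using u p by (intro W_mset) auto
    also have "\<dots> = W 0 (replicate d p) (W d u v)" by (simp add: W_append)
    also have "\<dots> = 0" using u v by (intro nil p W_supp) (simp add: add.commute)
    finally show "W 0 u (W i (replicate d p) v) = 0" .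
  qed
  \<comment> \<open>If \<open>r N \<noteq> 0\<close>, this is a nonzero vector of V_N; it is shown
    to be killed by all words of length \<open>N\<close>.\<close>
  have "unit_vec 0 = (0 :: nat \<Rightarrow> 'k)"
  proof (rule W_inj[of 0 N])
    show supp: "supp_below (r (0 + N)) (unit_vec 0 :: nat \<Rightarrow> 'k)"
      using \<open>r N \<noteq> 0\<close> by (intro supp_below_unit) simp
    fix w assume w: "length w = N" "set w \<subseteq> {..n}"
    have "\<exists>p\<le>n. count (mset w) p \<ge> d"
    proof (rule ccontr)
      assume "\<not> ?thesis"
      then have less: "count (mset w) p < d" if "p \<in> {..n}" for p
        using that \<open>\<not> (\<exists>p\<le>n. d \<le> count (mset w) p)\<close> by (meson atMost_iff not_le)
      have "N = (\<Sum>p\<in>set w. count (mset w) p)" using w by (metis size_mset size_multiset_overloaded_eq set_mset_mset)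
      also have "\<dots> \<le> (\<Sum>p\<le>n. count (mset w) p)" using w by (intro sum_mono2) auto
      also have "\<dots> < (\<Sum>p\<le>n. d)" using less by (intro sum_strict_mono) auto
      finally show False using N by simp
    qed
    then obtain p where p: "p \<le> n" "count (mset w) p \<ge> d" by blast
    then have "replicate_mset d p \<subseteq># mset w" by (simp add: count_le_replicate_mset_subset_eq)
    then obtain B where B: "mset w = B + replicate_mset d p" by (metis subset_mset.diff_add)
    obtain u where u: "mset u = B" using ex_mset by blast
    then have uw: "mset w = mset (u @ replicate d p)" using B by simp
    then have "length w = length (u @ replicate d p)" by (rule mset_eq_length)
    then have len: "length u + d = N" using w by simp
    have "set (u @ replicate d p) \<subseteq> {..n}" using uw w by (metis set_mset_mset)
    then have "W 0 w (unit_vec 0) = W 0 (u @ replicate d p) (unit_vec 0)" using uw by (intro W_mset)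
    also have "\<dots> = W 0 u (W (length u) (replicate d p) (unit_vec 0))" by (simp add: W_append)
    also have "\<dots> = 0" using nil'[OF p(1)] supp len lin_zero[OF W_lin] by simp
    finally show "W 0 w (unit_vec 0) = 0" .
  qed
  then have "unit_vec 0 0 = (0 :: 'k)" by simp
  then show False by (simp add: unit_vec_def)
qed

text \<open>
  The power series \<open>\<Sum>m. P i m t^m\<close> start with the identity and intertwine the deformed operators
  \<open>A i j + t c\<^sub>j A i p\<close> with the operators \<open>A i j\<close>. For \<open>E\<close> below, \<open>\<Sum>m. E p c i w m t^m\<close> is the word \<open>w\<close> in
  the deformed operators.
\<close>

definition deformation :: "nat \<Rightarrow> (nat \<Rightarrow> 'k) \<Rightarrow> (nat \<Rightarrow> nat \<Rightarrow> (nat \<Rightarrow> 'k) \<Rightarrow> nat \<Rightarrow> 'k) \<Rightarrow> bool" where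
  "deformation p c P \<longleftrightarrow>
     (\<forall>i m. lin (P i m)) \<and>
     (\<forall>i m v. supp_below (r i) (P i m v)) \<and>
     (\<forall>i v. supp_below (r i) v \<longrightarrow> P i 0 v = v) \<and>
     (\<forall>i j v. j \<le> n \<longrightarrow> P i 0 (A i j v) = A i j (P (Suc i) 0 v)) \<and>
     (\<forall>i j m v. j \<le> n \<longrightarrow>
        P i (Suc m) (A i j v) + scl (c j) (P i m (A i p v)) = A i j (P (Suc i) (Suc m) v))"

fun E :: "nat \<Rightarrow> (nat \<Rightarrow> 'k) \<Rightarrow> nat \<Rightarrow> nat list \<Rightarrow> nat \<Rightarrow> (nat \<Rightarrow> 'k) \<Rightarrow> nat \<Rightarrow> 'k" where
  "E p c i [] m v = (if m = 0 then v else 0)"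
| "E p c i (j # w) 0 v = A i j (E p c (Suc i) w 0 v)"
| "E p c i (j # w) (Suc m) v = A i j (E p c (Suc i) w (Suc m) v) + scl (c j) (A i p (E p c (Suc i) w m v))"

lemma E_supp: "supp_below (r (i + length w)) v \<Longrightarrow> supp_below (r i) (E p c i w m v)"
  by (cases w; cases m) (auto simp: supp_below_closed A_supp)

section \<open>Transporting relations along a deformation\<close>

lemma E_high: "length w < m \<Longrightarrow> E p c i w m v = 0"
proof (induction w arbitrary: i m)
  case (Cons j w)
  then show ?case by (cases m) (simp_all add: lin_zero[OF A_lin] del: plus_fun_apply zero_fun_apply scl_apply)
qed simp

text \<open>The power \<open>t ^ length w\<close> arises only by taking the deformation term at
  every letter. For a homogeneous relation f of degree d this produces the coefficient f(c)
  \<open>A p\<close>^d.\<close>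

lemma E_top: "E p c i w (length w) v = scl (prod_list (map c w)) (W i (replicate (length w) p) v)"
proof (induction w arbitrary: i)
  case (Cons j w)
  then show ?case by (simp add: E_high lin_zero[OF A_lin] lin_scl[OF A_lin] scl_scl del: plus_fun_apply zero_fun_apply scl_apply)
qed (simp add: fun_eq_iff)

text \<open>The coefficient at \<open>t ^ m\<close> of P(t) w(A + t c A_p) = w(A) P(t), written as a
  Cauchy product. The intertwining relation moves P past one letter at a time.\<close>

lemma deformation_word:
  assumes P: "deformation p c P" and "set w \<subseteq> {..n}"
  shows "(\<Sum>a\<le>m. P i a (E p c i w (m - a) v)) = W i w (P (i + length w) m v)"
  using assms(2)
proof (induction w arbitrary: i m)
  case Nil
  have P_lin: "lin (P i a)" for a using P by (simp add: deformation_def)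
  have "(\<Sum>a\<le>m. P i a (E p c i [] (m - a) v)) = (\<Sum>a\<in>{m}. P i m v)"
    by (rule sum.mono_neutral_cong_right) (auto simp: lin_zero[OF P_lin])
  then show ?case by simp
next
  case (Cons j w)
  then have j: "j \<le> n" by simp
  have P_lin: "lin (P i a)" for i a using P by (simp add: deformation_def)
  have P0: "P i 0 (A i j v) = A i j (P (Suc i) 0 v)" for v using P j by (simp add: deformation_def)
  have PS: "P i (Suc m) (A i j v) + scl (c j) (P i m (A i p v)) = A i j (P (Suc i) (Suc m) v)" for m v
    using P j by (simp add: deformation_def)
  have IH: "(\<Sum>a\<le>m. P (Suc i) a (E p c (Suc i) w (m - a) v)) = W (Suc i) w (P (Suc i + length w) m v)"
    for m using Cons by simp
  have "(\<Sum>a\<le>m. P i a (E p c i (j # w) (m - a) v)) =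
      A i j (\<Sum>a\<le>m. P (Suc i) a (E p c (Suc i) w (m - a) v))"
  proof (cases m)
    case 0
    then show ?thesis by (simp add: P0)
  next
    case (Suc m')
    let ?e = "\<lambda>b. E p c (Suc i) w b v"
    have "(\<Sum>a\<le>m. P i a (E p c i (j # w) (m - a) v)) =
        (\<Sum>a\<le>m'. P i a (E p c i (j # w) (Suc (m' - a)) v)) + P i m (E p c i (j # w) 0 v)"
      unfolding Suc by (simp add: Suc_diff_le cong: sum.cong_simp)
    also have "(\<Sum>a\<le>m'. P i a (E p c i (j # w) (Suc (m' - a)) v)) =
        (\<Sum>a\<le>m'. P i a (A i j (?e (m - a)))) + (\<Sum>a\<le>m'. scl (c j) (P i a (A i p (?e (m' - a)))))"
      unfolding Suc
      by (simp add: lin_add[OF P_lin] lin_scl[OF P_lin] sum.distrib Suc_diff_le cong: sum.cong_simp)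
    also have "\<dots> + P i m (E p c i (j # w) 0 v) =
        (\<Sum>a\<le>m. P i a (A i j (?e (m - a)))) + (\<Sum>a\<le>m'. scl (c j) (P i a (A i p (?e (m' - a)))))"
      unfolding Suc by (simp add: add_ac)
    \<comment> \<open>Splitting off \<open>a = 0\<close> shifts this sum, so that
      \<open>P i (Suc a)\<close> here and \<open>P i a\<close> in the other sum carry the same
      factor \<open>?e (m' - a)\<close>; \<open>PS\<close> then combines them.\<close>
    also have "(\<Sum>a\<le>m. P i a (A i j (?e (m - a)))) =
        P i 0 (A i j (?e m)) + (\<Sum>a\<le>m'. P i (Suc a) (A i j (?e (m' - a))))"
      unfolding Suc by (subst sum.atMost_Suc_shift) simp
    also have "\<dots> + (\<Sum>a\<le>m'. scl (c j) (P i a (A i p (?e (m' - a))))) =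
        A i j (P (Suc i) 0 (?e m)) + (\<Sum>a\<le>m'. A i j (P (Suc i) (Suc a) (?e (m' - a))))"
      by (simp add: P0 add.assoc PS flip: sum.distrib)
    also have "\<dots> = A i j (\<Sum>a\<le>m. P (Suc i) a (?e (m - a)))"
      unfolding Suc by (subst sum.atMost_Suc_shift) (simp add: lin_add[OF A_lin] lin_sum[OF A_lin] del: plus_fun_apply zero_fun_apply scl_apply)
    finally show ?thesis .
  qed
  then show ?case by (simp add: IH)
qed

text \<open>P(t) is invertible because it starts with the identity, and it carries the relation in
  the deformed operators to the relation in the original ones, which is zero. So every coefficient
  \<open>G m\<close> of the former vanishes; the one at \<open>t ^ d\<close> is a nonzero multiple
  of the power of \<open>A p\<close>.\<close>

lemma nilpotent_of_relation:
  assumes P: "deformation p c P"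
    and w: "\<And>x. x \<in> J \<Longrightarrow> set (w x) \<subseteq> {..n}" "\<And>x. x \<in> J \<Longrightarrow> length (w x) = d"
    and rel: "\<And>v. supp_below (r d) v \<Longrightarrow> (\<Sum>x\<in>J. scl (f x) (W 0 (w x) v)) = 0"
    and nz: "(\<Sum>x\<in>J. f x * prod_list (map c (w x))) \<noteq> 0"
    and v: "supp_below (r d) v"
  shows "W 0 (replicate d p) v = 0"
proof -
  have P_lin: "lin (P i a)" for i a using P by (simp add: deformation_def)
  define G where "G m = (\<Sum>x\<in>J. scl (f x) (E p c 0 (w x) m v))" for m
  have G_supp: "supp_below (r 0) (G m)" for m
    unfolding G_def using w v by (intro supp_below_sum supp_below_closed E_supp) simp
  have conv: "(\<Sum>a\<le>m. P 0 a (G (m - a))) = 0" for m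
  proof -
    have "(\<Sum>a\<le>m. P 0 a (G (m - a))) =
        (\<Sum>a\<le>m. \<Sum>x\<in>J. scl (f x) (P 0 a (E p c 0 (w x) (m - a) v)))"
      by (simp add: G_def lin_sum[OF P_lin] lin_scl[OF P_lin])
    also have "\<dots> = (\<Sum>x\<in>J. scl (f x) (\<Sum>a\<le>m. P 0 a (E p c 0 (w x) (m - a) v)))"
      by (subst sum.swap) (simp add: scl_sum)
    also have "\<dots> = (\<Sum>x\<in>J. scl (f x) (W 0 (w x) (P d m v)))"
      using deformation_word[OF P w(1), of _ 0 m v] w(2) by (intro sum.cong) simp_all
    also have "\<dots> = 0" using P by (intro rel) (simp add: deformation_def)
    finally show ?thesis .
  qed
  \<comment> \<open>Once the earlier coefficients of G vanish, the Cauchy product reduces to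
    \<open>P 0 0 (G m) = G m\<close>.\<close>
  have "G m = 0" for m
  proof (induction m rule: less_induct)
    case (less m)
    have "(\<Sum>a\<le>m. P 0 a (G (m - a))) = (\<Sum>a\<in>{0 :: nat}. P 0 0 (G m))"
      using less by (intro sum.mono_neutral_cong_right)
        (auto simp: lin_zero[OF P_lin] simp del: zero_fun_apply)
    also have "\<dots> = G m" using P G_supp by (simp add: deformation_def)
    finally show ?case using conv by simp
  qed
  then have "0 = (\<Sum>x\<in>J. scl (f x) (E p c 0 (w x) d v))" by (simp add: G_def)
  also have "\<dots> = (\<Sum>x\<in>J. scl (f x * prod_list (map c (w x))) (W 0 (replicate d p) v))"
  proof (rule sum.cong[OF refl])
    fix x assume "x \<in> J"
    then show "scl (f x) (E p c 0 (w x) d v) = scl (f x * prod_list (map c (w x))) (W 0 (replicate d p) v)"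
      using E_top[of p c 0 "w x" v] w(2) by (simp add: scl_scl del: scl_apply)
  qed
  also have "\<dots> = scl (\<Sum>x\<in>J. f x * prod_list (map c (w x))) (W 0 (replicate d p) v)"
    by (simp add: fun_eq_iff sum_fun_apply sum_distrib_right)
  finally show ?thesis using nz by (auto simp: fun_eq_iff)
qed

text \<open>
  The words are the monomials of degree \<open>d = n (q - 1)\<close> with exponents less than \<open>q\<close> in the variables
  \<open>1, \<dots>, n\<close>. They are indexed by the numbers below \<open>q ^ n\<close> through their base \<open>q\<close> digits, so that a
  relation between them becomes a polynomial in one variable at the point \<open>c\<^sub>0 = 1\<close>,
  \<open>c\<^sub>j = s ^ q ^ (j - 1)\<close>.
\<close>

lemma eventually_zero:
  assumes inf: "infinite (UNIV :: 'k set)" and n: "n > 0"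
    and def: "\<And>p c. p \<le> n \<Longrightarrow> \<exists>P. deformation p c P"
    and growth: "\<And>i. i \<ge> 1 \<Longrightarrow> r i \<le> K * i ^ (n - 1)"
  shows "\<exists>N. \<forall>i\<ge>N. r i = 0"
proof -
  \<comment> \<open>Since \<open>d \<le> n * q\<close>, the number \<open>r 0 * r d\<close> of
    conditions is at most \<open>r 0 * K * n ^ (n - 1) * q ^ (n - 1)\<close>, which must stay below
    the number \<open>q ^ n\<close> of monomials. The summand 2 makes this strict and also ensures
    \<open>q \<ge> 2\<close>, hence \<open>d \<ge> 1\<close>, where \<open>growth\<close>
    applies.\<close>
  define q where "q = r 0 * K * n ^ (n - 1) + 2"
  define d where "d = n * (q - 1)"
  have d: "d \<ge> 1" using n by (simp add: d_def q_def)
  have "r 0 * r d \<le> r 0 * (K * d ^ (n - 1))" using growth[OF d] by simp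
  also have "\<dots> \<le> r 0 * (K * (n * q) ^ (n - 1))"
    by (intro mult_le_mono2 power_mono) (simp_all add: d_def)
  also have "\<dots> = r 0 * K * n ^ (n - 1) * q ^ (n - 1)" by (simp add: power_mult_distrib)
  also have "\<dots> < q * q ^ (n - 1)" by (intro mult_strict_right_mono) (simp_all add: q_def)
  also have "\<dots> = q ^ n" using n by (cases n) auto
  finally have less: "r 0 * r d < q ^ n" .
  \<comment> \<open>Padding with the letter 0, which \<open>digit_word\<close> does not use, makes
    the monomials homogeneous of degree \<open>d\<close>; as \<open>c 0 = 1\<close>, it does not
    affect their values at \<open>c\<close>.\<close>
  define w where "w m = digit_word q n m @ replicate (d - length (digit_word q n m)) 0" for m
  have w: "set (w m) \<subseteq> {..n}" "length (w m) = d" for m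
    using digit_word_set[of q n m] digit_word_length[of q n m] by (auto simp: w_def d_def q_def)
  obtain f where f: "\<exists>m\<in>{..<q ^ n}. f m \<noteq> 0"
      "\<forall>(k, l)\<in>{..<r 0} \<times> {..<r d}. (\<Sum>m<q ^ n. W 0 (w m) (unit_vec l) k * f m) = 0"
    using underdetermined_solution[of "{..<r 0} \<times> {..<r d}" "{..<q ^ n}"
        "\<lambda>(k, l) m. W 0 (w m) (unit_vec l) k"] less
    by (auto simp: card_cartesian_product split_def)
  have rel: "(\<Sum>m<q ^ n. scl (f m) (W 0 (w m) v)) = 0" if v: "supp_below (r d) v" for v
  proof
    fix k
    show "(\<Sum>m<q ^ n. scl (f m) (W 0 (w m) v)) k = 0 k"
    proof (cases "k < r 0")
      case True
      have "(\<Sum>m<q ^ n. scl (f m) (W 0 (w m) v)) k =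
          (\<Sum>m<q ^ n. \<Sum>l<r d. (W 0 (w m) (unit_vec l) k * f m) * v l)"
        by (simp add: sum_fun_apply lin_coord[OF W_lin v] sum_distrib_left mult_ac)
      also have "\<dots> = (\<Sum>l<r d. (\<Sum>m<q ^ n. W 0 (w m) (unit_vec l) k * f m) * v l)"
        by (subst sum.swap) (simp add: sum_distrib_right)
      also have "\<dots> = 0" using f(2) True by (intro sum.neutral) auto
      finally show ?thesis by simp
    next
      case False
      have "supp_below (r 0) (\<Sum>m<q ^ n. scl (f m) (W 0 (w m) v))"
        using w v by (intro supp_below_sum supp_below_closed W_supp) simp
      then show ?thesis using False by (auto simp: supp_below_def)
    qed
  qed
  let ?p = "\<Sum>m<q ^ n. monom (f m) m"
  obtain m0 where m0: "m0 < q ^ n" "f m0 \<noteq> 0" using f(1) by blast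
  have "coeff ?p m0 = f m0" using m0 by (simp add: coeff_sum)
  then have "?p \<noteq> 0" using m0 by auto
  then obtain s where s: "poly ?p s \<noteq> 0" using ex_nonroot[OF inf] by blast
  define c where "c j = (if j = 0 then 1 else s ^ (q ^ (j - 1)))" for j
  have "prod_list (map c (w m)) = s ^ m" if "m < q ^ n" for m
  proof -
    have "prod_list (map c (digit_word q n m)) = s ^ (m mod q ^ n)"
      by (rule digit_word_prod) (simp add: c_def)
    then show ?thesis using that by (simp add: w_def c_def)
  qed
  then have nz: "(\<Sum>m<q ^ n. f m * prod_list (map c (w m))) \<noteq> 0"
    using s by (simp add: poly_sum poly_monom)
  have "W 0 (replicate d p) v = 0" if p: "p \<le> n" and v: "supp_below (r d) v" for p v
  proof -
    obtain P where "deformation p c P" using def[OF p, of c] by blast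
    then show ?thesis using nilpotent_of_relation[where w = w, OF _ w rel nz v] by simp
  qed
  then show ?thesis using eventually_zero_of_nilpotent[of d] d by (intro exI[of _ "(n + 1) * d"]) auto
qed

end

section \<open>Linear resolutions\<close>

text \<open>Entries of the argument from index \<open>s\<close> on are ignored, so the map is linear
  on all functions, as \<open>lin\<close> demands.\<close>

definition mat_vec :: "nat \<Rightarrow> (nat \<Rightarrow> nat \<Rightarrow> 'k :: field) \<Rightarrow> (nat \<Rightarrow> 'k) \<Rightarrow> nat \<Rightarrow> 'k" where
  "mat_vec s X w = (\<lambda>k. \<Sum>l<s. X k l * w l)"

lemma mat_vec_lin: "lin (mat_vec s X)"
  by (simp add: lin_def mat_vec_def fun_eq_iff distrib_left sum.distrib sum_distrib_left mult.left_commute)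

lemma mat_vec_supp: "(\<And>k l. l < s \<Longrightarrow> X k l \<noteq> 0 \<Longrightarrow> k < r) \<Longrightarrow> supp_below r (mat_vec s X w)"
  unfolding supp_below_def mat_vec_def by (metis (no_types, lifting) lessThan_iff mult_zero_left sum.neutral)

lemma mat_vec_mat_vec:
  "mat_vec s X (mat_vec t Y w) = mat_vec t (\<lambda>k l. \<Sum>u<s. X k u * Y u l) w"
proof
  fix k
  have "mat_vec s X (mat_vec t Y w) k = (\<Sum>u<s. \<Sum>l<t. X k u * Y u l * w l)"
    by (simp add: mat_vec_def sum_distrib_left mult.assoc)
  also have "\<dots> = (\<Sum>l<t. \<Sum>u<s. X k u * Y u l * w l)" by (rule sum.swap)
  finally show "mat_vec s X (mat_vec t Y w) k = mat_vec t (\<lambda>k l. \<Sum>u<s. X k u * Y u l) w k"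
    by (simp add: mat_vec_def sum_distrib_right)
qed

lemma mat_vec_cong: "(\<And>k l. l < s \<Longrightarrow> X k l = Y k l) \<Longrightarrow> mat_vec s X w = mat_vec s Y w"
  by (simp add: mat_vec_def)

lemma mat_vec_add_scl:
  "mat_vec s X w + scl c (mat_vec s Y w) = mat_vec s (\<lambda>k l. X k l + c * Y k l) w"
  by (simp add: mat_vec_def fun_eq_iff sum.distrib sum_distrib_left distrib_right mult.assoc)

section \<open>The commuting operators of a linear resolution\<close>

locale linear_res = free_res n M F
  for n :: nat and M :: "('k :: field, 'm) graded_rmod" and F :: "('k, 'm) resolution" +
  assumes minimal: "minimal_resolution n M F"
    and linear: "\<And>i. generated_in_degree n (int i) (res_mod n F i)"
begin

definition r where "r i = length (res_degs F i)"
text \<open>In a linear resolution the coordinates of \<open>d e_l\<close> are linear forms, with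
  \<open>a i j k l\<close> the coefficient of \<open>x_j\<close> in coordinate \<open>k\<close>.
  These scalars determine the differential.\<close>

definition a where "a i j k l = d i (fbasis l) k {j}"
definition A where "A i j = mat_vec (r (Suc i)) (a i j)"

lemma degs: "j < r i \<Longrightarrow> res_degs F i ! j = int i"
  using generated_in_degree_free[of n "int i" "res_degs F i" j] linear[of i] by (simp add: r_def res_mod_def)

lemma basis_grade: "l < r i \<Longrightarrow> fbasis l \<in> grade (res_mod n F i) (int i)"
  using fbasis_grade[of l "res_degs F i" n] degs[of l i] by (simp add: res_mod_def r_def)

lemma basis_closed: "l < r i \<Longrightarrow> fbasis l \<in> C i"
  using fbasis_closed by (simp add: res_mod_def r_def)

lemma grade_iff:
  "v \<in> grade (res_mod n F i) e \<longleftrightarrow>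
    (\<forall>k S. v k S \<noteq> 0 \<longrightarrow> k < r i \<and> S \<subseteq> {0..n} \<and> int (card S) = e - int i)"
  unfolding res_mod_def free_grade_iff using degs[of _ i] by (auto simp: r_def)

lemma hom_coord_supp:
  assumes "f \<in> graded_hom n (res_mod n F j) (res_mod n F i)" "l < r j" "f (fbasis l) k S \<noteq> 0"
  shows "k < r i \<and> S \<subseteq> {0..n} \<and> int (card S) = int j - int i"
  using graded_hom_grade[OF assms(1) basis_grade[OF assms(2)]] assms(3) by (simp add: grade_iff)

text \<open>Between generators of equal degree a map of degree zero is a scalar matrix, which acts
  on each coordinate \<open>S\<close> separately.\<close>

lemma coord_deg_0:
  assumes f: "f \<in> graded_hom n (res_mod n F i) (res_mod n F i)" and v: "v \<in> C i"
  shows "f v k S = (\<Sum>l<r i. f (fbasis l) k {} * v l S)"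
proof (cases "finite S")
  case True
  have "ext_mul (f (fbasis l) k) (v l) S = f (fbasis l) k {} * v l S" if l: "l < r i" for l
  proof -
    have "f (fbasis l) k T = 0" if "T \<noteq> {}" for T
      using hom_coord_supp[OF f l, of k T] that finite_subset[of T "{0..n}"] by auto
    then show ?thesis unfolding ext_mul_def using True by (subst sum.mono_neutral_right[of _ "{{}}"]) auto
  qed
  then show ?thesis
    using free_hom_coord[OF f[unfolded res_mod_def] v[unfolded res_mod_def]] by (simp add: r_def)
next
  case False
  then have "\<not> S \<subseteq> {0..n}" by (metis finite_atLeastAtMost finite_subset)
  then have "f v k S = 0" "v l S = 0" for l
    using v graded_hom_closed[OF f v] unfolding res_mod_def free_carrier_iff by meson+
  then show ?thesis by simp
qed

text \<open>Images of generators are linear forms here, so few products survive. The minus sign is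
  \<open>x_j' x_j = - x_j x_j'\<close>; it is the source of all commutation relations below.\<close>

lemma coord_deg_1:
  assumes f: "f \<in> graded_hom n (res_mod n F (Suc i)) (res_mod n F i)" and v: "v \<in> C (Suc i)"
  shows "f v k {j} = (\<Sum>l<r (Suc i). f (fbasis l) k {j} * v l {})"
    and "j < j' \<Longrightarrow> f v k {j, j'} =
      (\<Sum>l<r (Suc i). f (fbasis l) k {j} * v l {j'} - f (fbasis l) k {j'} * v l {j})"
proof -
  have coord: "f v k S = (\<Sum>l<r (Suc i). ext_mul (f (fbasis l) k) (v l) S)" for S
    using free_hom_coord[OF f[unfolded res_mod_def] v[unfolded res_mod_def]] by (simp add: r_def)
  have nz: "f (fbasis l) k T = 0" if "l < r (Suc i)" "card T \<noteq> 1" for l T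
    using hom_coord_supp[OF f that(1), of k T] that(2) by auto
  have Pow1: "Pow {j} = {{}, {j}}" by auto
  show "f v k {j} = (\<Sum>l<r (Suc i). f (fbasis l) k {j} * v l {})"
    unfolding coord by (intro sum.cong) (auto simp: ext_mul_def Pow1 nz)
  assume less: "j < j'"
  have Pow2: "Pow {j, j'} = {{}, {j}, {j'}, {j, j'}}" by auto
  have minus: "{j, j'} - {j} = {j'}" "{j, j'} - {j'} = {j}" using less by auto
  have inv: "{(s, t). s \<in> {j} \<and> t \<in> {j'} \<and> t < s} = {}"
      "{(s, t). s \<in> {j'} \<and> t \<in> {j} \<and> t < s} = {(j', j)}"
    using less by auto
  have sgn: "ext_sign {j} {j'} = 1" "ext_sign {j'} {j} = (-1 :: 'k)"
    unfolding ext_sign_def inv by simp_all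
  have "ext_mul (f (fbasis l) k) (v l) {j, j'} =
      f (fbasis l) k {j} * v l {j'} - f (fbasis l) k {j'} * v l {j}" if l: "l < r (Suc i)" for l
  proof -
    have "ext_mul (f (fbasis l) k) (v l) {j, j'} =
        (\<Sum>T\<in>{{j}, {j'}}. ext_sign T ({j, j'} - T) * f (fbasis l) k T * v l ({j, j'} - T))"
      unfolding ext_mul_def Pow2 using less nz[OF l] by (intro sum.mono_neutral_right) auto
    also have "\<dots> = f (fbasis l) k {j} * v l {j'} - f (fbasis l) k {j'} * v l {j}"
      using less by (simp add: minus sgn)
    finally show ?thesis .
  qed
  then show "f v k {j, j'} =
      (\<Sum>l<r (Suc i). f (fbasis l) k {j} * v l {j'} - f (fbasis l) k {j'} * v l {j})"
    unfolding coord by (intro sum.cong) auto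
qed

text \<open>A map lowering the position by two sends generators to quadratic forms, which are
  determined by their coefficients at pairs \<open>j < j'\<close>.\<close>

lemma hom_deg_2_eq_0:
  assumes f: "f \<in> graded_hom n (res_mod n F (Suc (Suc i))) (res_mod n F i)"
    and coord: "\<And>l k j j'. l < r (Suc (Suc i)) \<Longrightarrow> j < j' \<Longrightarrow> j' \<le> n \<Longrightarrow> f (fbasis l) k {j, j'} = 0"
    and v: "v \<in> C (Suc (Suc i))"
  shows "f v = 0"
proof -
  have "f (fbasis l) = 0" if l: "l < r (Suc (Suc i))" for l
  proof (intro ext, rule ccontr)
    fix k S assume nz: "f (fbasis l) k S \<noteq> 0 k S"
    then have "card S = 2" "S \<subseteq> {0..n}" using hom_coord_supp[OF f l, of k S] by auto
    then obtain j j' where S: "S = {j, j'}" "j \<noteq> j'" by (auto simp: card_2_iff)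
    have "f (fbasis l) k {min j j', max j j'} = 0"
      using S \<open>S \<subseteq> {0..n}\<close> by (intro coord[OF l]) auto
    moreover have "{min j j', max j j'} = S" unfolding S by (auto simp: min_def max_def)
    ultimately show False using nz by simp
  qed
  then have "ext_mul (f (fbasis l) k) (v l) S = 0" if "l < r (Suc (Suc i))" for l k S using that by simp
  then show ?thesis
    using free_hom_coord[OF f[unfolded res_mod_def] v[unfolded res_mod_def]] by (simp add: fun_eq_iff r_def)
qed

text \<open>The coefficient of \<open>x_j x_j'\<close> in \<open>d d = 0\<close>: because the
  variables anticommute, the coefficient matrices commute.\<close>

lemma a_commute:
  assumes "l < r (Suc (Suc i))"
  shows "(\<Sum>u<r (Suc i). a i j k u * a (Suc i) j' u l) = (\<Sum>u<r (Suc i). a i j' k u * a (Suc i) j u l)"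
proof -
  have *: "(\<Sum>u<r (Suc i). a i j k u * a (Suc i) j' u l) = (\<Sum>u<r (Suc i). a i j' k u * a (Suc i) j u l)"
    if "j < j'" for j j'
  proof -
    have "d i (d (Suc i) (fbasis l)) k {j, j'} = 0" using bdry_bdry[OF basis_closed[OF assms]] by simp
    then show ?thesis
      using coord_deg_1(2)[OF bdry_hom bdry_closed[OF basis_closed[OF assms]] that, of k]
      by (simp add: a_def sum_subtractf)
  qed
  show ?thesis using *[of j j'] *[of j' j] by (cases j j' rule: linorder_cases) auto
qed

sublocale A: commuting_operators n r A
proof
  show "lin (A i j)" for i j by (simp add: A_def mat_vec_lin)
  show "supp_below (r i) (A i j v)" for i j v
    unfolding A_def a_def by (rule mat_vec_supp) (use hom_coord_supp[OF bdry_hom] in blast)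
  show "A i j (A (Suc i) l v) = A i l (A (Suc i) j v)" for i j l v
    unfolding A_def mat_vec_mat_vec by (rule mat_vec_cong) (rule a_commute)
next
  fix i and v :: "nat \<Rightarrow> 'k" assume v: "supp_below (r (Suc i)) v" and Av: "\<And>j. j \<le> n \<Longrightarrow> A i j v = 0"
  \<comment> \<open>The vector \<open>v\<close> viewed as constants. If all \<open>A i j\<close>
    kill \<open>v\<close>, then \<open>x\<close> is a cycle, hence a boundary by exactness, and
    boundaries have no constant terms by minimality.\<close>
  define x where "x = (\<lambda>k (S :: nat set). if S = {} then v k else 0)"
  have x_grade: "x \<in> grade (res_mod n F (Suc i)) (int (Suc i))"
    using v by (auto simp: grade_iff x_def supp_below_def)
  then have x: "x \<in> C (Suc i)" unfolding res_mod_def by (rule free_grade_closed)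
  have "d i x = 0"
  proof (intro ext, rule ccontr)
    fix k S assume nz: "d i x k S \<noteq> 0 k S"
    then have "card S = 1" "S \<subseteq> {0..n}"
      using graded_hom_grade[OF bdry_hom x_grade] by (auto simp: grade_iff)
    then obtain j where j: "S = {j}" "j \<le> n" by (auto simp: card_1_singleton_iff)
    have "d i x k S = A i j v k"
      using coord_deg_1(1)[OF bdry_hom x] by (simp add: j A_def mat_vec_def a_def x_def)
    then show False using Av[OF j(2)] nz by simp
  qed
  then have "x \<in> res_cyc n M F (Suc i)" using x by (simp add: res_cyc_Suc)
  then obtain y where "y \<in> C (Suc (Suc i))" "x = d (Suc i) y" by (auto simp: cyc_eq)
  then have "x k {} = 0" for k using minimal_bdry_const[OF minimal] by blast
  then show "v = 0" by (simp add: x_def fun_eq_iff)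
qed

lemma diff_aug_zero:
  assumes "u \<in> C 0" "v \<in> C 0" "res_aug F u = res_aug F v"
  shows "u - v \<in> res_cyc n M F 0"
proof -
  interpret M: graded_rmodule n M by (rule M)
  have uv: "u - v \<in> C 0" using assms by (simp add: res_mod_def free_diff_closed)
  have "res_aug F ((u - v) + v) = res_aug F (u - v) \<oplus>\<^bsub>M\<^esub> res_aug F v"
    using graded_hom_add_apply[OF aug_hom uv assms(2)] by (simp add: res_mod_def)
  then show ?thesis
    using assms uv graded_hom_closed[OF aug_hom] by (metis M.add.r_cancel_one' diff_add_cancel res_cyc_0)
qed

section \<open>Deforming the differential when Ext^1 vanishes\<close>

context
  fixes p :: nat and c :: "nat \<Rightarrow> 'k"
  assumes p: "p \<le> n"
    and Ext: "\<And>h. h \<in> res_cocycles n F M 1 \<Longrightarrow>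
      \<exists>g\<in>graded_hom n (res_mod n F 0) M. \<forall>x\<in>C 1. h x = g (d 0 x)"
begin

text \<open>
  \<open>\<tau>\<close> is the derivative in \<open>t\<close> of the differential given by the operators \<open>A i j + t c\<^sub>j A i p\<close>: on
  generators it is \<open>A i p\<close> followed by multiplication by \<open>\<Sum>j. c\<^sub>j x\<^sub>j\<close>.
\<close>

lemma tau_exists:
  obtains \<tau> where "\<And>i. \<tau> i \<in> graded_hom n (res_mod n F (Suc i)) (res_mod n F i)"
    and "\<And>i l k j. l < r (Suc i) \<Longrightarrow> j \<le> n \<Longrightarrow> \<tau> i (fbasis l) k {j} = c j * a i p k l"
proof -
  define m where "m i l = (\<lambda>k S. if S \<subseteq> {0..n} \<and> card S = 1 then c (the_elem S) * a i p k l else 0)" for i l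
  have "\<exists>t. t \<in> graded_hom n (res_mod n F (Suc i)) (res_mod n F i) \<and>
      (\<forall>l<r (Suc i). t (fbasis l) = m i l)" for i
  proof -
    have m_grade: "m i l \<in> grade (res_mod n F i) (res_degs F (Suc i) ! l)" if l: "l < length (res_degs F (Suc i))" for l
    proof -
      have l': "l < r (Suc i)" using l by (simp add: r_def)
      show ?thesis
        unfolding grade_iff degs[OF l'] using hom_coord_supp[OF bdry_hom l']
        by (auto simp: m_def a_def split: if_splits)
    qed
    obtain t where "t \<in> graded_hom n (res_mod n F (Suc i)) (res_mod n F i)"
        "\<And>l. l < length (res_degs F (Suc i)) \<Longrightarrow> t (fbasis l) = m i l"
      by (rule free_hom_exists[OF res_mod_graded_rmodule m_grade, folded res_mod_def]) (assumption | rule that)+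
    then show ?thesis by (auto simp: r_def)
  qed
  then obtain \<tau> where \<tau>: "\<And>i. \<tau> i \<in> graded_hom n (res_mod n F (Suc i)) (res_mod n F i)"
      "\<And>i l. l < r (Suc i) \<Longrightarrow> \<tau> i (fbasis l) = m i l" by metis
  show ?thesis by (rule that[OF \<tau>(1)]) (simp add: \<tau>(2) m_def)
qed

definition \<tau> where "\<tau> = (SOME \<tau>. (\<forall>i. \<tau> i \<in> graded_hom n (res_mod n F (Suc i)) (res_mod n F i)) \<and>
  (\<forall>i l k j. l < r (Suc i) \<longrightarrow> j \<le> n \<longrightarrow> \<tau> i (fbasis l) k {j} = c j * a i p k l))"

lemma tau_hom: "\<tau> i \<in> graded_hom n (res_mod n F (Suc i)) (res_mod n F i)"
  and tau_basis: "l < r (Suc i) \<Longrightarrow> j \<le> n \<Longrightarrow> \<tau> i (fbasis l) k {j} = c j * a i p k l"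
proof -
  have "\<exists>\<tau>. (\<forall>i. \<tau> i \<in> graded_hom n (res_mod n F (Suc i)) (res_mod n F i)) \<and>
      (\<forall>i l k j. l < r (Suc i) \<longrightarrow> j \<le> n \<longrightarrow> \<tau> i (fbasis l) k {j} = c j * a i p k l)"
    by (rule tau_exists) blast
  from someI_ex[OF this]
  show "\<tau> i \<in> graded_hom n (res_mod n F (Suc i)) (res_mod n F i)"
    "l < r (Suc i) \<Longrightarrow> j \<le> n \<Longrightarrow> \<tau> i (fbasis l) k {j} = c j * a i p k l"
    unfolding \<tau>_def by blast+
qed

lemma tau_closed: "x \<in> C (Suc i) \<Longrightarrow> \<tau> i x \<in> C i"
  by (rule graded_hom_closed[OF tau_hom])

text \<open>The linear form \<open>\<Sum>j. c_j x_j\<close> has square zero in the exterior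
  algebra.\<close>

lemma tau_tau:
  assumes "x \<in> C (Suc (Suc i))"
  shows "\<tau> i (\<tau> (Suc i) x) = 0"
proof -
  let ?f = "compose (C (Suc (Suc i))) (\<tau> i) (\<tau> (Suc i))"
  have "?f x = 0"
  proof (rule hom_deg_2_eq_0[OF _ _ assms])
    show "?f \<in> graded_hom n (res_mod n F (Suc (Suc i))) (res_mod n F i)"
      by (rule graded_hom_compose[OF res_mod_graded_rmodule tau_hom tau_hom])
    fix l k j j' assume l: "l < r (Suc (Suc i))" and j: "j < j'" "j' \<le> n"
    then show "?f (fbasis l) k {j, j'} = 0"
      using coord_deg_1(2)[OF tau_hom tau_closed[OF basis_closed[OF l]] j(1)]
      by (simp add: compose_eq basis_closed tau_basis mult_ac)
  qed
  then show ?thesis using assms by (simp add: compose_eq)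
qed

text \<open>The coefficient of t in (d + t \<tau>)^2 = 0. It comes down to \<open>A p\<close>
  commuting with each \<open>A j\<close>.\<close>

lemma tau_bdry:
  assumes "x \<in> C (Suc (Suc i))"
  shows "\<tau> i (d (Suc i) x) + d i (\<tau> (Suc i) x) = 0"
proof -
  let ?X = "C (Suc (Suc i))"
  let ?f1 = "compose ?X (\<tau> i) (d (Suc i))" and ?f2 = "compose ?X (d i) (\<tau> (Suc i))"
  let ?f = "\<lambda>x\<in>?X. ?f1 x + ?f2 x"
  have "?f1 \<in> graded_hom n (res_mod n F (Suc (Suc i))) (res_mod n F i)"
    "?f2 \<in> graded_hom n (res_mod n F (Suc (Suc i))) (res_mod n F i)"
    using graded_hom_compose[OF res_mod_graded_rmodule] tau_hom bdry_hom by blast+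
  then have f: "?f \<in> graded_hom n (res_mod n F (Suc (Suc i))) (res_mod n F i)"
    unfolding res_mod_def by (rule graded_hom_free_add)
  have "?f x = 0"
  proof (rule hom_deg_2_eq_0[OF f _ assms])
    fix l k j j' assume l: "l < r (Suc (Suc i))" and j: "j < j'" "j' \<le> n"
    define m where "m x y = (\<Sum>u<r (Suc i). a i x k u * a (Suc i) y u l)" for x y
    have m: "m x y = m y x" for x y unfolding m_def by (rule a_commute[OF l])
    have "\<tau> i (d (Suc i) (fbasis l)) k {j, j'} = c j * m p j' - c j' * m p j"
      using coord_deg_1(2)[OF tau_hom bdry_closed[OF basis_closed[OF l]] j(1)] j
      by (simp add: tau_basis sum_subtractf m_def sum_distrib_left a_def mult_ac)
    moreover have "d i (\<tau> (Suc i) (fbasis l)) k {j, j'} = c j' * m j p - c j * m j' p"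
      using coord_deg_1(2)[OF bdry_hom tau_closed[OF basis_closed[OF l]] j(1)] j l
      by (simp add: tau_basis sum_subtractf m_def sum_distrib_left a_def mult_ac)
    ultimately show "?f (fbasis l) k {j, j'} = 0"
      using basis_closed[OF l] m[of p j] m[of p j'] by (simp add: compose_eq)
  qed
  then show ?thesis using assms by (simp add: compose_eq)
qed

text \<open>\<open>Q'\<close> and \<open>Q\<close> are two consecutive coefficients of P(t) in P(t)
  (d + t \<tau>) = d P(t), and the next one is constructed. The Ext hypothesis is used only in
  position 0; from there on exactness provides the lifts.\<close>

lemma deformation_step:
  assumes Q: "\<And>i. Q i \<in> graded_hom n (res_mod n F i) (res_mod n F i)"
    and Q': "\<And>i. Q' i \<in> graded_hom n (res_mod n F i) (res_mod n F i)"
    and QQ': "\<And>i x. x \<in> C (Suc i) \<Longrightarrow> Q i (d i x) + Q' i (\<tau> i x) = d i (Q (Suc i) x)"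
  obtains P where "\<And>i. P i \<in> graded_hom n (res_mod n F i) (res_mod n F i)"
    "\<And>i x. x \<in> C (Suc i) \<Longrightarrow> P i (d i x) + Q i (\<tau> i x) = d i (P (Suc i) x)"
proof -
  note Q_cl = graded_hom_closed[OF Q]
  have Q_add: "Q i (x + y) = Q i x + Q i y" if "x \<in> C i" "y \<in> C i" for i x y
    using free_hom_add[OF Q[unfolded res_mod_def]] that by (simp add: res_mod_def)
  have Q_zero: "Q i 0 = 0" for i by (rule free_hom_zero[OF Q[unfolded res_mod_def]])
  have Q'_zero: "Q' i 0 = 0" for i by (rule free_hom_zero[OF Q'[unfolded res_mod_def]])
  \<comment> \<open>\<open>Q \<tau>\<close> anticommutes with the differential up to moving
    \<open>Q\<close> past \<open>d\<close>. The correction by \<open>Q'\<close> that this move costs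
    is \<open>Q' \<tau> \<tau> = 0\<close>.\<close>
  have Q_tau_bdry: "Q i (\<tau> i (d (Suc i) x)) + d i (Q (Suc i) (\<tau> (Suc i) x)) = 0"
    if x: "x \<in> C (Suc (Suc i))" for i x
  proof -
    have "d i (Q (Suc i) (\<tau> (Suc i) x)) = Q i (d i (\<tau> (Suc i) x)) + Q' i (\<tau> i (\<tau> (Suc i) x))"
      using QQ'[OF tau_closed[OF x]] by simp
    then have "Q i (\<tau> i (d (Suc i) x)) + d i (Q (Suc i) (\<tau> (Suc i) x)) =
        Q i (\<tau> i (d (Suc i) x) + d i (\<tau> (Suc i) x))"
      using Q_add[OF tau_closed[OF bdry_closed[OF x]] bdry_closed[OF tau_closed[OF x]]]
      by (simp only: tau_tau[OF x] Q'_zero add_0_right)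
    then show ?thesis by (simp only: tau_bdry[OF x] Q_zero)
  qed
  define R where "R i = compose (C (Suc i)) (Q i) (\<tau> i)" for i
  have R_hom: "R i \<in> graded_hom n (res_mod n F (Suc i)) (res_mod n F i)" for i
    unfolding R_def by (rule graded_hom_compose[OF res_mod_graded_rmodule tau_hom Q])
  have R: "R i x = Q i (\<tau> i x)" if "x \<in> C (Suc i)" for i x using that by (simp add: R_def compose_eq)
  have start: "\<exists>P0 \<in> graded_hom n (res_mod n F 0) (res_mod n F 0).
      \<forall>x\<in>C (Suc 0). P0 (d 0 x) + Q 0 (\<tau> 0 x) \<in> res_cyc n M F 0"
  proof -
    \<comment> \<open>The obstruction to the next coefficient, a cocycle with values in
      \<open>M\<close>. By hypothesis it is \<open>g d\<close> for some \<open>g\<close>.\<close>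
    let ?h = "compose (C 1) (res_aug F) (R 0)"
    have "?h \<in> res_cocycles n F M 1"
      unfolding res_cocycles_def
    proof (intro CollectI conjI ballI)
      show "?h \<in> graded_hom n (res_mod n F 1) M"
        using graded_hom_compose[OF res_mod_graded_rmodule R_hom[of 0] aug_hom] by simp
      fix x assume x: "x \<in> C (Suc 1)"
      let ?y = "Q 1 (\<tau> 1 x)"
      have y: "?y \<in> C 1" using Q_cl tau_closed x by blast
      have "Q 0 (\<tau> 0 (d 1 x)) = - d 0 ?y"
        using Q_tau_bdry[of x 0] x by (simp add: eq_neg_iff_add_eq_0)
      also have "\<dots> = d 0 (- ?y)"
        using free_hom_diff[OF bdry_hom_free, of 0 0 ?y] free_hom_zero[OF bdry_hom_free] y
        by (simp add: res_mod_def free_zero_closed)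
      finally have "?h (d 1 x) = res_aug F (d 0 (- ?y))"
        using bdry_closed[OF x] by (simp add: compose_eq R)
      then show "?h (d 1 x) = \<zero>\<^bsub>M\<^esub>"
        using aug_bdry[of "- ?y"] y by (simp add: res_mod_def free_uminus_closed)
    qed
    from Ext[OF this] obtain g where g: "g \<in> graded_hom n (res_mod n F 0) M"
        "\<And>x. x \<in> C 1 \<Longrightarrow> ?h x = g (d 0 x)" by blast
    obtain g' where g': "g' \<in> graded_hom n (res_mod n F 0) (res_mod n F 0)"
        "\<And>x. x \<in> C 0 \<Longrightarrow> res_aug F (g' x) = g x" using lift_aug[OF g(1)] by blast
    show ?thesis
    proof (intro bexI ballI)
      \<comment> \<open>With \<open>- g'\<close> in position 0, the augmentations of the two
        summands cancel, so their sum is a cycle.\<close>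
      show "(\<lambda>x\<in>C 0. - g' x) \<in> graded_hom n (res_mod n F 0) (res_mod n F 0)"
        using g'(1) graded_hom_free_uminus unfolding res_mod_def by blast
      fix x assume x: "x \<in> C (Suc 0)"
      have "Q 0 (\<tau> 0 x) - g' (d 0 x) \<in> res_cyc n M F 0"
      proof (rule diff_aug_zero)
        show "res_aug F (Q 0 (\<tau> 0 x)) = res_aug F (g' (d 0 x))"
          using g(2)[of x] x g'(2)[OF bdry_closed[OF x]] by (simp add: compose_eq R)
      qed (use Q_cl[OF tau_closed[OF x]] graded_hom_closed[OF g'(1) bdry_closed[OF x]] in auto)
      then show "(\<lambda>x\<in>C 0. - g' x) (d 0 x) + Q 0 (\<tau> 0 x) \<in> res_cyc n M F 0"
        using bdry_closed[OF x] by (simp add: add.commute)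
    qed
  qed
  \<comment> \<open>The right-hand side of the lifting problem \<open>d P' = P d + Q \<tau>\<close>
    must consist of cycles; this is the condition passed on from each position to the next.\<close>
  define I where "I i P \<longleftrightarrow> P \<in> graded_hom n (res_mod n F i) (res_mod n F i) \<and>
      (\<forall>x\<in>C (Suc i). P (d i x) + Q i (\<tau> i x) \<in> res_cyc n M F i)" for i P
  have "\<exists>P. \<forall>i. I i (P i) \<and> (\<forall>x\<in>C (Suc i). P i (d i x) + Q i (\<tau> i x) = d i (P (Suc i) x))"
  proof (rule dependent_nat_choice)
    show "\<exists>P. I 0 P" using start unfolding I_def by blast
  next
    fix P i assume "I i P"
    then have P: "P \<in> graded_hom n (res_mod n F i) (res_mod n F i)"
      "\<And>x. x \<in> C (Suc i) \<Longrightarrow> P (d i x) + Q i (\<tau> i x) \<in> res_cyc n M F i" by (auto simp: I_def)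
    let ?g = "\<lambda>x\<in>C (Suc i). compose (C (Suc i)) P (d i) x + R i x"
    have "compose (C (Suc i)) P (d i) \<in> graded_hom n (res_mod n F (Suc i)) (res_mod n F i)"
      by (rule graded_hom_compose[OF res_mod_graded_rmodule bdry_hom P(1)])
    then have g: "?g \<in> graded_hom n (res_mod n F (Suc i)) (res_mod n F i)"
      using R_hom[of i] unfolding res_mod_def by (rule graded_hom_free_add)
    have g_eq: "?g x = P (d i x) + Q i (\<tau> i x)" if "x \<in> C (Suc i)" for x
      using that R by (simp add: compose_eq)
    have g_cyc: "?g x \<in> res_cyc n M F i" if "x \<in> C (Suc i)" for x
      using P(2)[OF that] g_eq[OF that] by simp
    obtain P' where P': "P' \<in> graded_hom n (res_mod n F (Suc i)) (res_mod n F (Suc i))"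
        "\<And>x. x \<in> C (Suc i) \<Longrightarrow> d i (P' x) = ?g x"
      by (rule lift_bdry[OF g g_cyc]) (assumption | rule that)+
    have eq: "P (d i x) + Q i (\<tau> i x) = d i (P' x)" if "x \<in> C (Suc i)" for x
      using P'(2)[OF that] g_eq[OF that] by simp
    have "P' (d (Suc i) x) + Q (Suc i) (\<tau> (Suc i) x) \<in> res_cyc n M F (Suc i)" if x: "x \<in> C (Suc (Suc i))" for x
    proof -
      have cl: "P' (d (Suc i) x) \<in> C (Suc i)" "Q (Suc i) (\<tau> (Suc i) x) \<in> C (Suc i)"
        using graded_hom_closed[OF P'(1) bdry_closed[OF x]] Q_cl[OF tau_closed[OF x]] by auto
      then have "d i (P' (d (Suc i) x) + Q (Suc i) (\<tau> (Suc i) x)) =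
          d i (P' (d (Suc i) x)) + d i (Q (Suc i) (\<tau> (Suc i) x))"
        using free_hom_add[OF bdry_hom_free] by (simp add: res_mod_def)
      also have "\<dots> = P (d i (d (Suc i) x)) +
          (Q i (\<tau> i (d (Suc i) x)) + d i (Q (Suc i) (\<tau> (Suc i) x)))"
        using eq[OF bdry_closed[OF x]] by (simp only: flip: add.assoc)
      also have "\<dots> = 0"
        using free_hom_zero[OF P(1)[unfolded res_mod_def]]
        by (simp only: Q_tau_bdry[OF x] bdry_bdry[OF x] add_0_right)
      finally show ?thesis using cl by (simp add: res_cyc_Suc res_mod_def free_add_closed)
    qed
    then have "I (Suc i) P'" using P'(1) by (simp add: I_def)
    then show "\<exists>P'. I (Suc i) P' \<and> (\<forall>x\<in>C (Suc i). P (d i x) + Q i (\<tau> i x) = d i (P' x))"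
      using eq by blast
  qed
  then obtain P where "\<And>i. I i (P i)"
      "\<And>i x. x \<in> C (Suc i) \<Longrightarrow> P i (d i x) + Q i (\<tau> i x) = d i (P (Suc i) x)" by blast
  then show ?thesis by (intro that[of P]) (auto simp: I_def)
qed

text \<open>Iterating \<open>deformation_step\<close> from the identity gives the coefficients of
  P(t) as maps of resolutions terms; being of degree zero they are scalar matrices, and these form
  the deformation.\<close>

lemma deformation_exists: "\<exists>P. A.deformation p c P"
proof -
  \<comment> \<open>The state is a pair of consecutive coefficients, since each step refers to the
    preceding one. It starts with the identity and, in place of a coefficient before it,
    zero.\<close>
  define ok where "ok X \<longleftrightarrow>
      (\<forall>i. fst X i \<in> graded_hom n (res_mod n F i) (res_mod n F i)) \<and>
      (\<forall>i. snd X i \<in> graded_hom n (res_mod n F i) (res_mod n F i)) \<and>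
      (\<forall>i. \<forall>x\<in>C (Suc i). fst X i (d i x) + snd X i (\<tau> i x) = d i (fst X (Suc i) x))"
    for X :: "(nat \<Rightarrow> 'k free_vec \<Rightarrow> 'k free_vec) \<times> (nat \<Rightarrow> 'k free_vec \<Rightarrow> 'k free_vec)"
  define P0 where "P0 i = (\<lambda>x\<in>C i. x)" for i
  define Z0 where "Z0 i = (\<lambda>x\<in>C i. (0 :: 'k free_vec))" for i
  have P0_hom: "P0 i \<in> graded_hom n (res_mod n F i) (res_mod n F i)" for i
    unfolding P0_def by (rule graded_hom_id[OF res_mod_graded_rmodule])
  have Z0_hom: "Z0 i \<in> graded_hom n (res_mod n F i) (res_mod n F i)" for i
    using graded_hom_zero[OF res_mod_graded_rmodule res_mod_graded_rmodule, of n F i F i]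
    by (simp add: Z0_def res_mod_def)
  have "\<exists>X. \<forall>m. (ok (X m) \<and> (m = 0 \<longrightarrow> X m = (P0, Z0))) \<and> snd (X (Suc m)) = fst (X m)"
  proof (rule dependent_nat_choice)
    have "ok (P0, Z0)"
      using P0_hom Z0_hom bdry_closed tau_closed by (simp add: ok_def) (simp add: P0_def Z0_def)
    then show "\<exists>X. ok X \<and> (0 = (0 :: nat) \<longrightarrow> X = (P0, Z0))" by blast
  next
    fix X and m :: nat assume "ok X \<and> (m = 0 \<longrightarrow> X = (P0, Z0))"
    then have X: "\<And>i. fst X i \<in> graded_hom n (res_mod n F i) (res_mod n F i)"
      "\<And>i. snd X i \<in> graded_hom n (res_mod n F i) (res_mod n F i)"
      "\<And>i x. x \<in> C (Suc i) \<Longrightarrow> fst X i (d i x) + snd X i (\<tau> i x) = d i (fst X (Suc i) x)"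
      unfolding ok_def by blast+
    obtain P where P: "\<And>i. P i \<in> graded_hom n (res_mod n F i) (res_mod n F i)"
        "\<And>i x. x \<in> C (Suc i) \<Longrightarrow> P i (d i x) + fst X i (\<tau> i x) = d i (P (Suc i) x)"
      by (rule deformation_step[OF X]) (assumption | rule that)+
    then have "ok (P, fst X)" using X(1) by (simp add: ok_def)
    then show "\<exists>Y. (ok Y \<and> (Suc m = 0 \<longrightarrow> Y = (P0, Z0))) \<and> snd Y = fst X" by force
  qed
  then obtain X where X: "\<And>m. ok (X m)" "X 0 = (P0, Z0)" "\<And>m. snd (X (Suc m)) = fst (X m)" by blast
  define H where "H m i = fst (X m) i" for m i
  have H_hom: "H m i \<in> graded_hom n (res_mod n F i) (res_mod n F i)" for m i
    using X(1)[of m] by (simp add: ok_def H_def)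
  have H0: "H 0 i x = x" if "x \<in> C i" for i x using that X(2) by (simp add: H_def P0_def)
  have HS: "H (Suc m) i (d i x) + H m i (\<tau> i x) = d i (H (Suc m) (Suc i) x)" if "x \<in> C (Suc i)" for m i x
    using X(1)[of "Suc m"] that unfolding ok_def H_def X(3) by blast
  define P where "P i m = mat_vec (r i) (\<lambda>k l. H m i (fbasis l) k {})" for i m
  have H_cl: "H m i (fbasis l) \<in> C i" if "l < r i" for m i l
    by (rule graded_hom_closed[OF H_hom basis_closed[OF that]])
  \<comment> \<open>On arbitrary functions the coefficient at \<open>t ^ 0\<close> cuts off the
    entries from \<open>r i\<close> on; it is the identity on the vectors that represent elements of
    V_i.\<close>
  have trunc: "P i 0 v = (\<lambda>k. if k < r i then v k else 0)" for i v
  proof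
    fix k
    have "P i 0 v k = (\<Sum>l<r i. (if l = k then v l else 0))"
      unfolding P_def mat_vec_def
    proof (rule sum.cong[OF refl])
      fix l assume "l \<in> {..<r i}"
      then have "H 0 i (fbasis l) = fbasis l" by (simp add: H0 basis_closed)
      then show "H 0 i (fbasis l) k {} * v l = (if l = k then v l else 0)"
        by (simp only:) (simp add: fbasis_def)
    qed
    then show "P i 0 v k = (if k < r i then v k else 0)" by simp
  qed
  have "A.deformation p c P"
    unfolding A.deformation_def
  proof (intro conjI allI impI)
    show "lin (P i m)" for i m by (simp add: P_def mat_vec_lin)
    show "supp_below (r i) (P i m v)" for i m v
      unfolding P_def by (rule mat_vec_supp) (use hom_coord_supp[OF H_hom] in blast)
    show P0: "P i 0 v = v" if "supp_below (r i) v" for i v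
      using that by (auto simp: trunc supp_below_def fun_eq_iff)
    show "P i 0 (A i j v) = A i j (P (Suc i) 0 v)" for i j v
      unfolding P0[OF A.A_supp] by (simp add: trunc A_def mat_vec_def)
    fix i j m v assume j: "j \<le> n"
    have "P i (Suc m) (A i j v) + scl (c j) (P i m (A i p v)) =
        mat_vec (r (Suc i)) (\<lambda>k l. (\<Sum>u<r i. H (Suc m) i (fbasis u) k {} * a i j u l) +
          c j * (\<Sum>u<r i. H m i (fbasis u) k {} * a i p u l)) v"
      unfolding P_def A_def mat_vec_mat_vec mat_vec_add_scl ..
    also have "\<dots> = mat_vec (r (Suc i))
        (\<lambda>k l. \<Sum>u<r (Suc i). a i j k u * H (Suc m) (Suc i) (fbasis l) u {}) v"
    proof (rule mat_vec_cong)
      fix k l assume l: "l < r (Suc i)"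
      note b = basis_closed[OF l]
      \<comment> \<open>Comparing the coefficients of \<open>x_j\<close> in the recursion, evaluated
        at a generator, turns it into the matrix identity for \<open>A i j\<close> and
        \<open>A i p\<close>.\<close>
      have "H (Suc m) i (d i (fbasis l)) k {j} + H m i (\<tau> i (fbasis l)) k {j} =
          d i (H (Suc m) (Suc i) (fbasis l)) k {j}"
        using HS[OF b] by (metis plus_fun_apply)
      then show "(\<Sum>u<r i. H (Suc m) i (fbasis u) k {} * a i j u l) +
          c j * (\<Sum>u<r i. H m i (fbasis u) k {} * a i p u l) =
          (\<Sum>u<r (Suc i). a i j k u * H (Suc m) (Suc i) (fbasis l) u {})"
        unfolding coord_deg_0[OF H_hom bdry_closed[OF b]] coord_deg_0[OF H_hom tau_closed[OF b]]
          coord_deg_1(1)[OF bdry_hom H_cl[OF l]]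
        by (simp add: tau_basis[OF l j] sum_distrib_left mult_ac flip: a_def)
    qed
    also have "\<dots> = A i j (P (Suc i) (Suc m) v)" unfolding P_def A_def mat_vec_mat_vec ..
    finally show "P i (Suc m) (A i j v) + scl (c j) (P i m (A i p v)) = A i j (P (Suc i) (Suc m) v)" .
  qed
  then show ?thesis by blast
qed

end

end

section \<open>From bounded growth to complexity zero\<close>

theorem theorem3p2:
  fixes n :: nat and M :: "('k :: alg_closed_field, 'm) graded_rmod"
  assumes "graded_rmodule n M" and "fin_gen n M"
    and "indecomposable n M"
    and "linear_module n M"
    and "complexity n M \<noteq> 0" and "complexity n M \<le> n"
  shows "carrier (Ext n 1 M M) \<noteq> {\<one>\<^bsub>Ext n 1 M M\<^esub>}"
proof
  assume Ext: "carrier (Ext n 1 M M) = {\<one>\<^bsub>Ext n 1 M M\<^esub>}"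
  obtain F where res: "minimal_resolution n M F" "\<And>i. generated_in_degree n (int i) (res_mod n F i)"
    using assms(4) by (auto simp: linear_module_def)
  interpret linear_res n M F
    using assms(1) res by (simp add: linear_res_def linear_res_axioms_def free_res_def minimal_imp_free)
  have betti: "betti n M i = r i" for i using betti_eq[OF assms(1) res(1)] by (simp add: r_def)
  let ?S = "{d. \<exists>c :: rat. c > 0 \<and> (\<forall>i\<ge>1. of_nat (r i) \<le> c * of_nat i powi (int d - 1))}"
  have cx: "complexity n M = Inf ?S" by (simp add: complexity_def betti)
  \<comment> \<open>The set must be nonempty for its infimum to be attained. The exponent
    \<open>n + 1\<close> of \<open>polynomial_growth\<close> corresponds to \<open>n + 2\<close>, as
    the exponent in \<open>?S\<close> is \<open>d - 1\<close>.\<close>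
  have "n + 2 \<in> ?S"
  proof (intro CollectI exI conjI allI impI)
    let ?c = "of_nat (r 0 * 2 ^ (n + 1)) + 1 :: rat"
    show "?c > 0" by (simp add: add_nonneg_pos)
    fix i :: nat assume i: "i \<ge> 1"
    have "r i \<le> r 0 * (i + 1) ^ (n + 1)" by (rule A.polynomial_growth)
    also have "\<dots> \<le> r 0 * (2 * i) ^ (n + 1)" using i by (intro mult_le_mono2 power_mono) auto
    also have "\<dots> = r 0 * 2 ^ (n + 1) * i ^ (n + 1)" by (simp add: power_mult_distrib)
    finally have "of_nat (r i) \<le> (of_nat (r 0 * 2 ^ (n + 1) * i ^ (n + 1)) :: rat)" by (simp only: of_nat_le_iff)
    also have "\<dots> \<le> ?c * of_nat i ^ (n + 1)" by (simp add: distrib_right)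
    also have "of_nat i ^ (n + 1) = (of_nat i :: rat) powi (int (n + 2) - 1)"
      by (subst power_int_of_nat[symmetric]) (simp add: algebra_simps)
    finally show "of_nat (r i) \<le> ?c * of_nat i powi (int (n + 2) - 1)" .
  qed
  then have "complexity n M \<in> ?S" unfolding cx by (intro Inf_nat_def1) blast
  then have "\<exists>c :: rat. c > 0 \<and> (\<forall>i\<ge>1. of_nat (r i) \<le> c * of_nat i powi (int (complexity n M) - 1))"
    by (rule CollectD)
  then obtain c :: rat where c: "c > 0"
    "\<forall>i\<ge>1. of_nat (r i) \<le> c * of_nat i powi (int (complexity n M) - 1)" by blast
  define K where "K = nat \<lceil>c\<rceil>"
  have growth: "r i \<le> K * i ^ (n - 1)" if i: "i \<ge> 1" for i
  proof -
    \<comment> \<open>Positive complexity makes the exponent a natural number, which can then be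
      raised to \<open>n - 1\<close>.\<close>
    have "int (complexity n M) - 1 = int (complexity n M - 1)" using assms(5) by simp
    then have "(of_nat i :: rat) powi (int (complexity n M) - 1) = of_nat i ^ (complexity n M - 1)"
      by (simp only: power_int_of_nat)
    then have "(of_nat (r i) :: rat) \<le> c * of_nat i ^ (complexity n M - 1)"
      using c(2)[rule_format, OF i] by (simp only:)
    also have "\<dots> \<le> of_nat K * of_nat i ^ (n - 1)"
    proof (intro mult_mono power_increasing)
      show "c \<le> of_nat K" using c(1) by (simp add: K_def)
    qed (use i assms(6) in auto)
    finally have "(of_nat (r i) :: rat) \<le> of_nat (K * i ^ (n - 1))" by simp
    then show ?thesis by (simp only: of_nat_le_iff)
  qed
  have "\<exists>P. A.deformation p c P" if "p \<le> n" for p c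
    by (rule deformation_exists[OF that Ext_1_trivial[OF assms(1) free_res_axioms Ext]])
  moreover have "n > 0" using assms(5,6) by simp
  ultimately obtain N where N: "\<And>i. i \<ge> N \<Longrightarrow> r i = 0"
    using A.eventually_zero[OF alg_closed_infinite _ _ growth] by blast
  have "0 \<in> ?S"
  proof (intro CollectI exI conjI allI impI)
    \<comment> \<open>For \<open>d = 0\<close> the bound reads \<open>i * r i \<le> c\<close>. Only
      finitely many terms are nonzero, so their sum is a bound, and adding 1 keeps it
      positive.\<close>
    let ?c = "1 + of_nat (\<Sum>i<N. i * r i) :: rat"
    show "?c > 0" by (intro add_pos_nonneg zero_less_one of_nat_0_le_iff)
    fix i :: nat assume i: "i \<ge> 1"
    have "i * r i \<le> (\<Sum>i<N. i * r i)"
    proof (cases "i < N")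
      case True
      then show ?thesis by (intro member_le_sum) auto
    qed (simp add: N)
    then have "of_nat (i * r i) \<le> (of_nat (\<Sum>i<N. i * r i) :: rat)" by (simp only: of_nat_le_iff)
    then have "of_nat (r i) * of_nat i \<le> ?c" by (simp add: mult.commute)
    then show "of_nat (r i) \<le> ?c * of_nat i powi (int 0 - 1)" using i by (simp add: field_simps)
  qed
  then have "Inf ?S \<le> 0" unfolding Inf_nat_def by (rule Least_le)
  then show False using assms(5) cx by simp
qed

end
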